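(* There exist absolute constants $c>0$ and $n_0\ge1$ such that for all integers $n\ge n_0$ and all $\epsilon\in(0,1/2)$ the following holds. Any randomized algorithm that, given entry-query access to any nonzero positive semidefinite matrix $\mathbf{A}\in\mathbb{R}^{n\times n}$, outputs an estimate $\widehat F$ satisfying $$(1-\epsilon)\|\mathbf{A}\|_{\mathrm F}^2\le\widehat F\le(1+\epsilon)\|\mathbf{A}\|_{\mathrm F}^2\quad\text{with probability at least }2/3$$ must read at least $c\cdot\min\{n/\epsilon^2,\,n^2\}$ entries of $\mathbf{A}$ in the worst case.
   Context: $\|\cdot\|_{\mathrm F}$ is the Frobenius norm. A positive semidefinite matrix is a real symmetric matrix with $\mathbf{x}^\top\mathbf{A}\mathbf{x}\ge0$ for all $\mathbf{x}$. Access model: the algorithm learns about $\mathbf{A}$ only by adaptively querying individual entries $\mathbf{A}_{ij}$; it may use arbitrary internal randomness and may depend on $n$ and $\epsilon$. The worst case is over nonzero positive semidefinite inputs $\mathbf{A}\in\mathbb{R}^{n\times n}$ and over the algorithm's internal randomness. *)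

theory Defs
  imports "HOL-Probability.Probability_Measure" "Jordan_Normal_Form.Matrix"
begin

definition psd_mat :: "nat \<Rightarrow> real mat \<Rightarrow> bool" where
  "psd_mat n A \<longleftrightarrow> A \<in> carrier_mat n n \<and> transpose_mat A = A \<and>
     (\<forall>x \<in> carrier_vec n. 0 \<le> scalar_prod x (A *\<^sub>v x))"

definition frobenius_norm :: "real mat \<Rightarrow> real" where
  "frobenius_norm A = sqrt (\<Sum>i<dim_row A. \<Sum>j<dim_col A. (A $$ (i, j))\<^sup>2)"

text \<open>
  A deterministic adaptive entry-query algorithm is a decision tree: it either halts with an
  output, or reads the entry at some position and continues in a way that may depend arbitrarily
  on the value read. The algorithm learns about the input only through these reads, and every
  run is finite.
\<close>

datatype query_alg = Output real | Query nat nat "real \<Rightarrow> query_alg"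

primrec queries_within :: "nat \<Rightarrow> query_alg \<Rightarrow> bool" where
  "queries_within n (Output r) \<longleftrightarrow> True"
| "queries_within n (Query i j k) \<longleftrightarrow> i < n \<and> j < n \<and> (\<forall>a. queries_within n (k a))"

primrec output_on :: "real mat \<Rightarrow> query_alg \<Rightarrow> real" where
  "output_on A (Output r) = r"
| "output_on A (Query i j k) = output_on A (k (A $$ (i, j)))"

text \<open>
  The set of positions read in the run on \<open>A\<close>: rereading an entry is free, while \<open>(i, j)\<close> and
  \<open>(j, i)\<close> count as two entries.
\<close>

primrec entries_read :: "real mat \<Rightarrow> query_alg \<Rightarrow> (nat \<times> nat) set" where
  "entries_read A (Output r) = {}"
| "entries_read A (Query i j k) = insert (i, j) (entries_read A (k (A $$ (i, j))))"

text \<open>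
  A randomized algorithm is a probability distribution on deterministic ones. The sigma-algebra
  on \<open>query_alg\<close> is arbitrary, so this covers internal randomness from any probability space
  \<open>\<Omega>\<close>: a map \<open>D\<close> from \<open>\<Omega>\<close> to \<open>query_alg\<close> induces such a distribution on its range, with the
  sets whose preimage under \<open>D\<close> is an event as measurable sets. Having the randomness on one
  fixed type also lets constants be chosen uniformly over all randomized algorithms.
\<close>

definition randomized_query_alg :: "nat \<Rightarrow> query_alg measure \<Rightarrow> bool" where
  "randomized_query_alg n M \<longleftrightarrow> prob_space M \<and> (\<forall>t \<in> space M. queries_within n t)"

text \<open>
  The success set is required to be an event for each input; no joint measurability in the
  input and the randomness is assumed.
\<close>

definition estimates_frobenius_sq :: "nat \<Rightarrow> real \<Rightarrow> query_alg measure \<Rightarrow> bool" where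
  "estimates_frobenius_sq n \<epsilon> M \<longleftrightarrow>
     (\<forall>A. psd_mat n A \<and> A \<noteq> 0\<^sub>m n n \<longrightarrow>
        (let S = {t \<in> space M.
                   (1 - \<epsilon>) * (frobenius_norm A)\<^sup>2 \<le> output_on A t \<and>
                   output_on A t \<le> (1 + \<epsilon>) * (frobenius_norm A)\<^sup>2}
         in S \<in> sets M \<and> measure M S \<ge> 2 / 3))"

end

theory Submission
  imports Defs "HOL-Combinatorics.Permutations"
begin

text \<open>
  Put \<open>m = n div 2\<close>. The hard input is the identity plus the adjacency matrix of a matching
  between \<open>{..<m}\<close> and \<open>{m..<2 * m}\<close>: vertex \<open>p\<close> is joined to \<open>m + \<sigma> p\<close> if its bit is set, where \<open>\<sigma>\<close> is a
  uniformly random permutation. Up to permutation this is a sum of blocks with all entries 1, hence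
  positive semidefinite, and its squared norm is \<open>n\<close> plus twice the number of edges. The vertices
  are split into \<open>G\<close> groups of equal size, \<open>G\<close> proportional to \<open>min (1 / \<epsilon>\<^sup>2) n\<close>, and all vertices of a group
  share one fair random bit. The squared norm then fluctuates by about \<open>n / sqrt G\<close>, a
  large multiple of \<open>\<epsilon> * n\<close>, so a correct output requires the bits of a constant fraction of the groups,
  and therefore about \<open>G\<close> reads that hit the graph of \<open>\<sigma>\<close>. As a read hits with probability
  \<open>O(1 / m)\<close>, about \<open>n * G\<close> reads are needed. This argument needs \<open>G\<close> to be large; if \<open>\<epsilon>\<close> or \<open>1 / n\<close> is
  bounded below, it suffices that a single hidden diagonal entry cannot be found with \<open>n / 4\<close> reads.
\<close>

section \<open>Binomial coefficients and averaging\<close>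

text \<open>Consecutive central binomials have ratio \<open>2 * (2 * j + 1) / (j + 1)\<close>. With
  the factor \<open>2 * j + 1\<close> in front, the induction step reduces to
  \<open>(2 * j + 1) * (2 * j + 3) \<le> 4 * (j + 1)\<^sup>2\<close>.\<close>

lemma central_binomial_square_le: "(2 * j + 1) * ((2 * j) choose j)\<^sup>2 \<le> 16 ^ j"
proof (induction j)
  case 0
  show ?case by simp
next
  case (Suc j)
  let ?a = "(2 * j) choose j" and ?b = "(2 * Suc j) choose Suc j"
  have odd: "Suc j * (Suc (2 * j) choose j) = Suc (2 * j) * ?a"
    using binomial_absorb_comp[of "Suc (2 * j)" j] by (simp add: Suc_diff_le)
  have "Suc j * ?b = Suc (Suc (2 * j)) * (Suc (2 * j) choose j)"
    using Suc_times_binomial[of j "Suc (2 * j)"] by simp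
  also have "\<dots> = 2 * (Suc j * (Suc (2 * j) choose j))" by simp
  also have "\<dots> = 2 * (Suc (2 * j) * ?a)" by (simp only: odd)
  finally have step: "Suc j * ?b = 2 * (2 * j + 1) * ?a" by simp
  have "(j + 1)\<^sup>2 * ((2 * Suc j + 1) * ?b\<^sup>2) = (2 * j + 3) * (Suc j * ?b)\<^sup>2"
    by (simp add: power2_eq_square algebra_simps)
  also have "\<dots> = 4 * ((2 * j + 3) * (2 * j + 1)) * ((2 * j + 1) * ?a\<^sup>2)"
    by (simp only: step) (simp add: power2_eq_square algebra_simps)
  also have "\<dots> \<le> 4 * (4 * (j + 1)\<^sup>2) * 16 ^ j"
    by (intro mult_le_mono[OF _ Suc.IH]) (simp add: power2_eq_square algebra_simps)
  finally show ?case by (simp add: mult.assoc)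
qed

lemma binomial_le_power2_div_sqrt:
  assumes "0 < n"
  shows "real (n choose k) \<le> 2 ^ n / sqrt (real n)"
proof -
  have "n * (n choose (n div 2))\<^sup>2 \<le> 4 ^ n"
  proof (cases "even n")
    case True
    then obtain j where n: "n = 2 * j" by (elim evenE)
    have "n * (n choose (n div 2))\<^sup>2 \<le> (2 * j + 1) * ((2 * j) choose j)\<^sup>2"
      by (simp add: n)
    also have "\<dots> \<le> 16 ^ j" by (rule central_binomial_square_le)
    finally show ?thesis by (simp add: n power_mult)
  next
    case False
    then obtain j where n: "n = 2 * j + 1" by (elim oddE)
    \<comment> \<open>For odd \<open>n\<close> the two middle coefficients agree and add up to the
      central one of the next row.\<close>
    have "Suc (2 * j) choose Suc j = Suc (2 * j) choose j"
      using binomial_symmetric[of j "Suc (2 * j)"] by (simp add: Suc_diff_le)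
    hence "(2 * Suc j) choose Suc j = 2 * (n choose (n div 2))"
      by (simp add: n)
    moreover have "4 * (n * c\<^sup>2) \<le> (2 * Suc j + 1) * (2 * c)\<^sup>2" for c :: nat
      by (simp add: n power_mult_distrib)
    ultimately have "4 * (n * (n choose (n div 2))\<^sup>2) \<le> (2 * Suc j + 1) * ((2 * Suc j) choose Suc j)\<^sup>2"
      by (simp only:)
    also have "\<dots> \<le> 16 ^ Suc j" by (rule central_binomial_square_le)
    also have "\<dots> = 4 * 4 ^ n" by (simp add: n power_mult)
    finally show ?thesis by simp
  qed
  hence "real n * (real (n choose (n div 2)))\<^sup>2 \<le> (2 ^ n)\<^sup>2"
    using of_nat_mono[of "n * (n choose (n div 2))\<^sup>2" "4 ^ n", where 'a = real]
    by (simp add: power_mult [symmetric] power_mult mult.commute[of n 2])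
  hence "sqrt (real n * (real (n choose (n div 2)))\<^sup>2) \<le> 2 ^ n"
    by (intro real_le_lsqrt) auto
  hence "sqrt (real n) * real (n choose (n div 2)) \<le> 2 ^ n"
    by (simp add: real_sqrt_mult)
  moreover have "sqrt (real n) * real (n choose k) \<le> sqrt (real n) * real (n choose (n div 2))"
    by (intro mult_left_mono) (auto simp: binomial_maximum)
  ultimately have "sqrt (real n) * real (n choose k) \<le> 2 ^ n" by linarith
  thus ?thesis
    using assms by (simp add: pos_le_divide_eq mult.commute)
qed

text \<open>The expected number of \<open>x\<close> with \<open>t \<in> S x\<close> is at least
  \<open>p * card I\<close>, so some \<open>t\<close> reaches this value. The finite sum of
  indicators is integrable because each \<open>S x\<close> is an event.\<close>

lemma exists_good_on_average:
  fixes S :: "'i \<Rightarrow> 'a set"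
  assumes "prob_space M" and "finite I"
    and sets: "\<And>x. x \<in> I \<Longrightarrow> S x \<in> sets M"
    and prob: "\<And>x. x \<in> I \<Longrightarrow> p \<le> measure M (S x)"
  obtains t where "t \<in> space M" "p * real (card I) \<le> real (card {x \<in> I. t \<in> S x})"
proof -
  interpret prob_space M by fact
  let ?f = "\<lambda>t. \<Sum>x\<in>I. indicator (S x) t :: real"
  have int: "integrable M ?f"
    using sets by (intro Bochner_Integration.integrable_sum) (auto simp: integrable_indicator_iff emeasure_eq_measure)
  have "p * card I \<le> (\<Sum>x\<in>I. measure M (S x))"
    using sum_mono[of I "\<lambda>_. p", OF prob] by (simp add: mult.commute)
  also have "\<dots> = (\<Sum>x\<in>I. expectation (indicator (S x)))"
    using sets by (intro sum.cong) (auto dest: sets.sets_into_space simp: Int_absorb2)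
  also have "\<dots> = expectation ?f"
    using sets by (subst Bochner_Integration.integral_sum)
      (auto simp: integrable_indicator_iff emeasure_eq_measure)
  finally have "\<not> expectation ?f < p * card I" by simp
  hence "\<not> (AE t in M. ?f t < p * card I)"
    using expectation_less[OF int] by blast
  then obtain t where t: "t \<in> space M" "p * card I \<le> ?f t"
    by (meson AE_I2 not_less)
  have "?f t = real (card {x \<in> I. t \<in> S x})"
    using \<open>finite I\<close> by (simp add: indicator_def sum.If_cases Int_def)
  with t that show ?thesis by auto
qed

section \<open>Searching for the edges of a hidden matching\<close>

text \<open>
  A node asks for the pair \<open>(i, j)\<close> of a left and a right vertex of a bipartite graph; the answer says
  only whether it is an edge.
\<close>

datatype bool_tree = Leaf real | Node nat nat "bool \<Rightarrow> bool_tree"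

primrec tree_within :: "nat \<Rightarrow> bool_tree \<Rightarrow> bool" where
  "tree_within m (Leaf r) \<longleftrightarrow> True"
| "tree_within m (Node i j k) \<longleftrightarrow> i < m \<and> j < m \<and> (\<forall>a. tree_within m (k a))"

primrec tree_output :: "(nat \<Rightarrow> nat \<Rightarrow> bool) \<Rightarrow> bool_tree \<Rightarrow> real" where
  "tree_output E (Leaf r) = r"
| "tree_output E (Node i j k) = tree_output E (k (E i j))"

primrec tree_reads :: "(nat \<Rightarrow> nat \<Rightarrow> bool) \<Rightarrow> bool_tree \<Rightarrow> (nat \<times> nat) set" where
  "tree_reads E (Leaf r) = {}"
| "tree_reads E (Node i j k) = insert (i, j) (tree_reads E (k (E i j)))"

lemma finite_tree_reads: "finite (tree_reads E t)"
  by (induction t) auto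

definition edge :: "(nat \<Rightarrow> nat) \<Rightarrow> (nat \<Rightarrow> bool) \<Rightarrow> nat \<Rightarrow> nat \<Rightarrow> bool" where
  "edge \<sigma> b i j \<longleftrightarrow> \<sigma> i = j \<and> b i"

definition graph_of :: "('a \<Rightarrow> 'b) \<Rightarrow> ('a \<times> 'b) set" where
  "graph_of f = {(x, y). f x = y}"

text \<open>
  \<open>D\<close> is the set of pairs already asked for, and \<open>P\<close> the set of those that lie on the graph of the
  hidden permutation ("hits"). A hit may still be answered negatively, namely if \<open>b i\<close> is false.
\<close>

definition consistent_perms :: "nat \<Rightarrow> (nat \<times> nat) set \<Rightarrow> (nat \<times> nat) set \<Rightarrow> (nat \<Rightarrow> nat) set" where
  "consistent_perms m D P =
     {\<sigma>. \<sigma> permutes {..<m} \<and> (\<forall>(x, y)\<in>D. \<sigma> x = y \<longleftrightarrow> (x, y) \<in> P)}"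

lemma finite_consistent_perms: "finite (consistent_perms m D P)"
  by (rule finite_subset[OF _ finite_permutations[of "{..<m}"]]) (auto simp: consistent_perms_def)

text \<open>
  Composing a permutation through \<open>(i, j)\<close> with the transposition of \<open>i\<close> and \<open>x\<close> keeps it consistent
  for at least \<open>m / 4\<close> choices of \<open>x\<close>, and no consistent permutation is obtained twice in this way.
\<close>

lemma card_consistent_perms_hit:
  assumes "P \<subseteq> D" "D \<subseteq> {..<m} \<times> {..<m}" "(i, j) \<notin> D" "i < m" "j < m"
    and P: "4 * card P \<le> m"
    and row: "4 * card {y. (i, y) \<in> D} \<le> m"
    and col: "4 * card {x. (x, j) \<in> D} \<le> m"
  shows "m * card {\<sigma> \<in> consistent_perms m D P. \<sigma> i = j} \<le> 4 * card (consistent_perms m D P)"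
proof -
  let ?C = "consistent_perms m D P"
  let ?H = "{\<sigma> \<in> ?C. \<sigma> i = j}"
  \<comment> \<open>The composed permutation sends \<open>i\<close> to \<open>\<sigma> x\<close> and
    \<open>x\<close> to \<open>j\<close>. Neither pair may have been read, and \<open>x\<close> must
    not lie on a known hit, which the swap would destroy.\<close>
  define V where "V \<sigma> = {x. x < m \<and> (x, j) \<notin> D \<and> (i, \<sigma> x) \<notin> D \<and> (x, \<sigma> x) \<notin> P}" for \<sigma>
  have "finite D"
    using assms(2) by (rule finite_subset) simp
  hence "finite P"
    using \<open>P \<subseteq> D\<close> by (rule rev_finite_subset)
  have finrow: "finite {y. (i, y) \<in> D}" and fincol: "finite {x. (x, j) \<in> D}"
    by (rule finite_subset[of _ "snd ` D"]; force simp: \<open>finite D\<close>)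
       (rule finite_subset[of _ "fst ` D"]; force simp: \<open>finite D\<close>)
  have V: "m \<le> 4 * card (V \<sigma>)" if "\<sigma> \<in> ?H" for \<sigma>
  proof -
    have inj: "inj \<sigma>"
      using that by (auto simp: consistent_perms_def permutes_inj)
    have fin: "finite {x. (i, \<sigma> x) \<in> D}" "finite {x. (x, \<sigma> x) \<in> P}"
      using finite_vimageI[OF finrow inj] finite_vimageI[OF \<open>finite P\<close>, of "\<lambda>x. (x, \<sigma> x)"]
      by (auto simp: vimage_def inj_on_def)
    have "card {x. (i, \<sigma> x) \<in> D} \<le> card {y. (i, y) \<in> D}"
      by (rule card_inj_on_le[of \<sigma>]) (use inj finrow in \<open>auto intro: inj_on_subset\<close>)
    moreover have "card {x. (x, \<sigma> x) \<in> P} \<le> card P"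
      by (rule card_inj_on_le[of "\<lambda>x. (x, \<sigma> x)"]) (use \<open>finite P\<close> in \<open>auto intro: inj_onI\<close>)
    \<comment> \<open>Each of the three excluded sets has at most \<open>m / 4\<close>
      elements.\<close>
    moreover have "m \<le> card (V \<sigma> \<union> {x. (x, j) \<in> D} \<union> {x. (i, \<sigma> x) \<in> D} \<union> {x. (x, \<sigma> x) \<in> P})"
      using card_mono[of "V \<sigma> \<union> {x. (x, j) \<in> D} \<union> {x. (i, \<sigma> x) \<in> D} \<union> {x. (x, \<sigma> x) \<in> P}" "{..<m}"]
        fincol fin by (auto simp: V_def)
    moreover have "card (V \<sigma> \<union> {x. (x, j) \<in> D} \<union> {x. (i, \<sigma> x) \<in> D} \<union> {x. (x, \<sigma> x) \<in> P})
      \<le> card (V \<sigma>) + card {x. (x, j) \<in> D} + card {x. (i, \<sigma> x) \<in> D} + card {x. (x, \<sigma> x) \<in> P}"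
      by (meson add_le_mono card_Un_le le_refl order_trans)
    ultimately show ?thesis
      using P row col by linarith
  qed
  have finV: "finite (V \<sigma>)" for \<sigma>
    by (rule finite_subset[of _ "{..<m}"]) (auto simp: V_def)
  have "m * card ?H \<le> (\<Sum>\<sigma>\<in>?H. 4 * card (V \<sigma>))"
    using sum_mono[of ?H "\<lambda>_. m", OF V] by (simp add: mult.commute)
  also have "\<dots> = 4 * card (Sigma ?H V)"
    using finV by (subst card_SigmaI) (auto simp: sum_distrib_left finite_consistent_perms)
  also have "card (Sigma ?H V) \<le> card ?C"
  proof (rule card_inj_on_le[where f = "\<lambda>(\<sigma>, x). \<sigma> \<circ> Transposition.transpose i x"])
    show "inj_on (\<lambda>(\<sigma>, x). \<sigma> \<circ> Transposition.transpose i x) (Sigma ?H V)"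
    proof (rule inj_onI, clarify, goal_cases)
      case (1 \<sigma> x \<tau> y)
      have eq: "\<sigma> \<circ> Transposition.transpose i x = \<tau> \<circ> Transposition.transpose i y" by fact
      have "inj \<sigma>" "inj \<tau>"
        using 1 by (auto simp: consistent_perms_def permutes_inj)
      \<comment> \<open>As \<open>\<sigma> i = \<tau> i = j\<close>, the point \<open>x\<close> can
        be read off the composition as the preimage of \<open>j\<close>; undoing the swap then
        recovers \<open>\<sigma>\<close>.\<close>
      have "\<tau> (Transposition.transpose i y x) = \<sigma> (Transposition.transpose i x x)"
        using fun_cong[OF eq, of x] by (simp only: comp_apply)
      also have "\<dots> = \<tau> i"
        using 1 by simp
      finally have "\<tau> (Transposition.transpose i y x) = \<tau> i" .
      hence "Transposition.transpose i y x = i"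
        using \<open>inj \<tau>\<close> by (simp add: inj_eq)
      hence "x = y"
        by (metis transpose_apply_second transpose_involutory)
      moreover have "\<sigma> = \<tau>"
      proof -
        have "\<sigma> = (\<sigma> \<circ> Transposition.transpose i x) \<circ> Transposition.transpose i x"
          by (simp add: fun_eq_iff)
        also have "\<dots> = \<tau>"
          by (subst eq) (simp add: \<open>x = y\<close> fun_eq_iff)
        finally show ?thesis .
      qed
      ultimately show ?case by simp
    qed
    show "(\<lambda>(\<sigma>, x). \<sigma> \<circ> Transposition.transpose i x) ` Sigma ?H V \<subseteq> ?C"
    proof (clarify, goal_cases)
      case (1 \<tau> \<sigma> x)
      have "\<sigma> permutes {..<m}" and \<sigma>: "\<And>x y. (x, y) \<in> D \<Longrightarrow> \<sigma> x = y \<longleftrightarrow> (x, y) \<in> P"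
        using 1 by (auto simp: consistent_perms_def)
      moreover have "Transposition.transpose i x permutes {..<m}"
        using 1 \<open>i < m\<close> by (intro permutes_swap_id) (auto simp: V_def)
      moreover have "(\<sigma> \<circ> Transposition.transpose i x) u = v \<longleftrightarrow> (u, v) \<in> P" if "(u, v) \<in> D" for u v
        using 1 that \<sigma>[OF that] assms(1,3)
        by (cases "u = i"; cases "u = x") (auto simp: V_def Transposition.transpose_def)
      ultimately show ?case
        by (auto simp: consistent_perms_def permutes_compose)
    qed
  qed (rule finite_consistent_perms)
  finally show ?thesis by simp
qed

text \<open>
  In a row or column with more than \<open>m / 4\<close> reads the swapping bound fails. A hit there is paid for by
  these earlier reads: each deposits \<open>4 / m\<close> in its row and in its column, to be spent when the
  row or column is hit, which happens only once.
\<close>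

definition hit_potential :: "nat \<Rightarrow> (nat \<times> nat) set \<Rightarrow> (nat \<times> nat) set \<Rightarrow> real" where
  "hit_potential m D P =
     4 / real m * real (card {(x, y) \<in> D. x \<notin> fst ` P} + card {(x, y) \<in> D. y \<notin> snd ` P})"

text \<open>
  The truncated subtraction \<open>h - card P\<close> stops the count after \<open>h\<close> hits, which keeps \<open>P\<close> small enough
  for the swapping bound.
\<close>

lemma sum_hits_le:
  assumes "0 < m" "4 * h \<le> m" "tree_within m t" "P \<subseteq> D" "D \<subseteq> {..<m} \<times> {..<m}"
  shows "(\<Sum>\<sigma>\<in>consistent_perms m D P.
            real (min (h - card P) (card (graph_of \<sigma> \<inter> tree_reads (edge \<sigma> b) t - D))))
       \<le> (\<Sum>\<sigma>\<in>consistent_perms m D P. 12 / real m * real (card (tree_reads (edge \<sigma> b) t - D)))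
         + real (card (consistent_perms m D P)) * hit_potential m D P"
  using assms(3-5)
proof (induction t arbitrary: D P)
  case (Leaf r)
  show ?case by (simp add: hit_potential_def)
next
  case (Node i j k)
  let ?C = "consistent_perms m D P"
  let ?R = "\<lambda>\<sigma>. tree_reads (edge \<sigma> b)"
  have ij: "i < m" "j < m" and k: "\<And>a. tree_within m (k a)"
    using Node.prems by auto
  note PD = \<open>P \<subseteq> D\<close> and Dm = \<open>D \<subseteq> {..<m} \<times> {..<m}\<close>
  have "finite D"
    using Dm by (rule finite_subset) simp
  hence "finite P"
    using PD by (rule rev_finite_subset)
  have finD: "finite {(x, y). (x, y) \<in> D \<and> R x y}" for R
    by (rule finite_subset[OF _ \<open>finite D\<close>]) auto
  show ?case
  proof (cases "(i, j) \<in> D")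
    case True
    \<comment> \<open>A repeated read has the same answer for every consistent permutation, so the
      induction hypothesis applies with \<open>D\<close> and \<open>P\<close> unchanged.\<close>
    define a where "a \<longleftrightarrow> (i, j) \<in> P \<and> b i"
    have "?R \<sigma> (Node i j k) - D = ?R \<sigma> (k a) - D"
      and "graph_of \<sigma> \<inter> ?R \<sigma> (Node i j k) - D = graph_of \<sigma> \<inter> ?R \<sigma> (k a) - D" if "\<sigma> \<in> ?C" for \<sigma>
    proof -
      have "edge \<sigma> b i j = a"
        using that True by (auto simp: consistent_perms_def edge_def a_def)
      thus "?R \<sigma> (Node i j k) - D = ?R \<sigma> (k a) - D"
        and "graph_of \<sigma> \<inter> ?R \<sigma> (Node i j k) - D = graph_of \<sigma> \<inter> ?R \<sigma> (k a) - D"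
        using True by auto
    qed
    thus ?thesis
      using Node.IH[OF _ k PD Dm, of a] by simp
  next
    case False
    define D' where "D' = insert (i, j) D"
    define P' where "P' = insert (i, j) P"
    define C1 where "C1 = consistent_perms m D' P'"
    define C2 where "C2 = consistent_perms m D' P"
    have D': "D' \<subseteq> {..<m} \<times> {..<m}" "P' \<subseteq> D'" "P \<subseteq> D'"
      using ij PD Dm by (auto simp: D'_def P'_def)
    have "(i, j) \<notin> P"
      using False PD by auto
    have C1: "C1 = {\<sigma> \<in> ?C. \<sigma> i = j}" and C2: "C2 = {\<sigma> \<in> ?C. \<sigma> i \<noteq> j}"
      using False \<open>(i, j) \<notin> P\<close>
      by (auto simp: C1_def C2_def consistent_perms_def D'_def P'_def)
    have fin: "finite C1" "finite C2"
      by (simp_all add: C1_def C2_def finite_consistent_perms)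
    have C: "?C = C1 \<union> C2" "C1 \<inter> C2 = {}"
      by (auto simp: C1 C2)
    have cardC: "card ?C = card C1 + card C2"
      unfolding C(1) using C(2) fin by (simp add: card_Un_disjoint)
    show ?thesis
    \<comment> \<open>After \<open>h\<close> hits the truncated count is zero, while the right-hand
      side is nonnegative.\<close>
    proof (cases "card P < h")
      case False
      thus ?thesis
        by (auto simp: hit_potential_def intro!: add_nonneg_nonneg sum_nonneg)
    next
      case True
      have new: "card (?R \<sigma> (Node i j k) - D) = Suc (card (?R \<sigma> (k (edge \<sigma> b i j)) - D'))" for \<sigma>
      proof -
        have "?R \<sigma> (Node i j k) - D = insert (i, j) (?R \<sigma> (k (edge \<sigma> b i j)) - D')"
          using False by (auto simp: D'_def)
        thus ?thesis
          by (simp add: finite_tree_reads D'_def)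
      qed
      have hit: "min (h - card P) (card (graph_of \<sigma> \<inter> ?R \<sigma> (Node i j k) - D)) =
          Suc (min (h - card P') (card (graph_of \<sigma> \<inter> ?R \<sigma> (k (b i)) - D')))" if "\<sigma> \<in> C1" for \<sigma>
      proof -
        have "\<sigma> i = j" using that by (simp add: C1)
        hence "graph_of \<sigma> \<inter> ?R \<sigma> (Node i j k) - D
            = insert (i, j) (graph_of \<sigma> \<inter> ?R \<sigma> (k (b i)) - D')"
          using False by (auto simp: D'_def graph_of_def edge_def)
        hence "card (graph_of \<sigma> \<inter> ?R \<sigma> (Node i j k) - D)
            = Suc (card (graph_of \<sigma> \<inter> ?R \<sigma> (k (b i)) - D'))"
          by (simp add: finite_tree_reads D'_def)
        thus ?thesis
          using True \<open>(i, j) \<notin> P\<close> \<open>finite P\<close> by (simp add: P'_def)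
      qed
      have miss: "graph_of \<sigma> \<inter> ?R \<sigma> (Node i j k) - D = graph_of \<sigma> \<inter> ?R \<sigma> (k False) - D'"
        if "\<sigma> \<in> C2" for \<sigma>
        using that by (auto simp: C2 D'_def graph_of_def edge_def)
      have e1: "edge \<sigma> b i j = b i" if "\<sigma> \<in> C1" for \<sigma>
        using that by (simp add: C1 edge_def)
      have e2: "edge \<sigma> b i j = False" if "\<sigma> \<in> C2" for \<sigma>
        using that by (simp add: C2 edge_def)
      let ?f1 = "\<lambda>\<sigma>. real (min (h - card P') (card (graph_of \<sigma> \<inter> ?R \<sigma> (k (b i)) - D')))"
      let ?g1 = "\<lambda>\<sigma>. 12 / real m * real (card (?R \<sigma> (k (b i)) - D'))"
      let ?f2 = "\<lambda>\<sigma>. real (min (h - card P) (card (graph_of \<sigma> \<inter> ?R \<sigma> (k False) - D')))"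
      let ?g2 = "\<lambda>\<sigma>. 12 / real m * real (card (?R \<sigma> (k False) - D'))"
      let ?F = "\<Sum>\<sigma>\<in>?C. real (min (h - card P) (card (graph_of \<sigma> \<inter> ?R \<sigma> (Node i j k) - D)))"
      let ?G = "\<Sum>\<sigma>\<in>?C. 12 / real m * real (card (?R \<sigma> (Node i j k) - D))"
      have F: "?F = real (card C1) + sum ?f1 C1 + sum ?f2 C2"
      proof -
        have "?F = (\<Sum>\<sigma>\<in>C1. 1 + ?f1 \<sigma>) + sum ?f2 C2"
          unfolding C(1) using C(2) fin
          by (subst sum.union_disjoint) (auto simp: hit miss simp del: tree_reads.simps intro!: sum.cong)
        thus ?thesis by (simp add: sum.distrib)
      qed
      have G: "?G = 12 / real m * real (card ?C) + sum ?g1 C1 + sum ?g2 C2"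
      proof -
        have "?G = (\<Sum>\<sigma>\<in>C1. 12 / real m + ?g1 \<sigma>) + (\<Sum>\<sigma>\<in>C2. 12 / real m + ?g2 \<sigma>)"
          unfolding C(1) using C(2) fin
          by (subst sum.union_disjoint)
             (auto simp: new e1 e2 algebra_simps add_divide_distrib simp del: tree_reads.simps intro!: sum.cong)
        thus ?thesis
          by (simp add: sum.distrib cardC algebra_simps add_divide_distrib)
      qed
      have IH1: "sum ?f1 C1 \<le> sum ?g1 C1 + real (card C1) * hit_potential m D' P'"
        unfolding C1_def by (rule Node.IH[OF _ k D'(2,1)]) simp
      have IH2: "sum ?f2 C2 \<le> sum ?g2 C2 + real (card C2) * hit_potential m D' P"
        unfolding C2_def by (rule Node.IH[OF _ k D'(3,1)]) simp
      \<comment> \<open>Of the \<open>12 / m\<close> charged per new read, \<open>8 / m\<close> are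
        the deposits into its row and column, made when the read misses. The other
        \<open>4 / m\<close> cover hits in light rows and columns.\<close>
      have pot2: "hit_potential m D' P \<le> hit_potential m D P + 8 / real m"
      proof -
        have "card {(x, y) \<in> D'. x \<notin> fst ` P} \<le> Suc (card {(x, y) \<in> D. x \<notin> fst ` P})"
          by (rule order_trans[OF card_mono[of "insert (i, j) {(x, y) \<in> D. x \<notin> fst ` P}"]])
             (auto simp: D'_def card_insert_if finD)
        moreover have "card {(x, y) \<in> D'. y \<notin> snd ` P} \<le> Suc (card {(x, y) \<in> D. y \<notin> snd ` P})"
          by (rule order_trans[OF card_mono[of "insert (i, j) {(x, y) \<in> D. y \<notin> snd ` P}"]])
             (auto simp: D'_def card_insert_if finD)
        ultimately have "card {(x, y) \<in> D'. x \<notin> fst ` P} + card {(x, y) \<in> D'. y \<notin> snd ` P}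
            \<le> card {(x, y) \<in> D. x \<notin> fst ` P} + card {(x, y) \<in> D. y \<notin> snd ` P} + 2"
          by linarith
        hence "hit_potential m D' P
            \<le> 4 / real m * real (card {(x, y) \<in> D. x \<notin> fst ` P} + card {(x, y) \<in> D. y \<notin> snd ` P} + 2)"
          unfolding hit_potential_def by (intro mult_left_mono of_nat_mono) auto
        also have "\<dots> = hit_potential m D P + 8 / real m"
          unfolding hit_potential_def by (simp add: distrib_left)
        finally show ?thesis .
      qed
      \<comment> \<open>A hit is paid for either by the \<open>4 / m\<close> share, taken over all
        of \<open>?C\<close>, or by the potential that it releases.\<close>
      have pot1: "real (card C1) + real (card C1) * hit_potential m D' P'
          \<le> 4 / real m * real (card ?C) + real (card C1) * hit_potential m D P"
      proof (cases "C1 = {}")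
        case True
        thus ?thesis by simp
      next
        case ne: False
        then obtain \<sigma> where "\<sigma> \<in> ?C" "\<sigma> i = j" by (auto simp: C1)
        hence \<sigma>: "inj \<sigma>" "\<And>x y. (x, y) \<in> P \<Longrightarrow> \<sigma> x = y"
          using PD by (auto simp: consistent_perms_def permutes_inj)
        have i: "i \<notin> fst ` P" and j: "j \<notin> snd ` P"
          using \<sigma> \<open>\<sigma> i = j\<close> \<open>(i, j) \<notin> P\<close> by (force dest: injD)+
        let ?row = "{y. (i, y) \<in> D}" and ?col = "{x. (x, j) \<in> D}"
        have fins: "finite ?row" "finite ?col"
          by (rule finite_subset[of _ "snd ` D"]; force simp: \<open>finite D\<close>)
             (rule finite_subset[of _ "fst ` D"]; force simp: \<open>finite D\<close>)
        \<comment> \<open>Earlier reads in row \<open>i\<close> count before the hit but not after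
          it, and the new pair itself lies in a row that is now hit. The same holds for column
          \<open>j\<close> below.\<close>
        have "card {(x, y) \<in> D'. x \<notin> fst ` P'} + card (Pair i ` ?row)
            = card ({(x, y) \<in> D'. x \<notin> fst ` P'} \<union> Pair i ` ?row)"
          using fins by (intro card_Un_disjoint[symmetric])
            (auto simp: D'_def P'_def intro: finite_subset[OF _ \<open>finite D\<close>])
        also have "\<dots> \<le> card {(x, y) \<in> D. x \<notin> fst ` P}"
          using i by (intro card_mono) (auto simp: D'_def P'_def intro: finite_subset[OF _ \<open>finite D\<close>])
        finally have r: "card {(x, y) \<in> D'. x \<notin> fst ` P'} + card ?row \<le> card {(x, y) \<in> D. x \<notin> fst ` P}"
          by (simp add: card_image inj_on_def)
        have "card {(x, y) \<in> D'. y \<notin> snd ` P'} + card ((\<lambda>x. (x, j)) ` ?col)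
            = card ({(x, y) \<in> D'. y \<notin> snd ` P'} \<union> (\<lambda>x. (x, j)) ` ?col)"
          using fins by (intro card_Un_disjoint[symmetric])
            (auto simp: D'_def P'_def intro: finite_subset[OF _ \<open>finite D\<close>])
        also have "\<dots> \<le> card {(x, y) \<in> D. y \<notin> snd ` P}"
          using j by (intro card_mono) (auto simp: D'_def P'_def intro: finite_subset[OF _ \<open>finite D\<close>])
        finally have c: "card {(x, y) \<in> D'. y \<notin> snd ` P'} + card ?col \<le> card {(x, y) \<in> D. y \<notin> snd ` P}"
          by (simp add: card_image inj_on_def)
        have drop: "hit_potential m D' P' + 4 / real m * real (card ?row + card ?col) \<le> hit_potential m D P"
        proof -
          have "4 / real m * real ((card {(x, y) \<in> D'. x \<notin> fst ` P'} + card {(x, y) \<in> D'. y \<notin> snd ` P'})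
              + (card ?row + card ?col))
            \<le> hit_potential m D P"
            unfolding hit_potential_def using r c
            by (intro mult_left_mono) (auto simp del: of_nat_add simp: of_nat_add[symmetric])
          thus ?thesis
            unfolding hit_potential_def by (simp only: of_nat_add distrib_left)
        qed
        show ?thesis
        \<comment> \<open>If row and column are light, the swapping bound limits the share of
          permutations with a hit here. Otherwise the earlier reads in them release potential at
          least 1.\<close>
        proof (cases "4 * card ?row \<le> m \<and> 4 * card ?col \<le> m")
          case light: True
          have "m * card C1 \<le> 4 * card ?C"
            unfolding C1 using light \<open>card P < h\<close> \<open>4 * h \<le> m\<close> False ij PD Dm
            by (intro card_consistent_perms_hit) auto
          hence "real m * real (card C1) \<le> 4 * real (card ?C)"
            by (metis of_nat_le_iff of_nat_mult of_nat_numeral)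
          hence "real (card C1) \<le> 4 / real m * real (card ?C)"
            using \<open>0 < m\<close> by (simp add: field_simps)
          moreover have "real (card C1) * hit_potential m D' P' \<le> real (card C1) * hit_potential m D P"
            using drop by (intro mult_left_mono) (auto intro: order_trans[rotated])
          ultimately show ?thesis by linarith
        next
          case False
          hence "m \<le> 4 * (card ?row + card ?col)"
            by auto
          hence "real m \<le> 4 * real (card ?row + card ?col)"
            by (metis of_nat_le_iff of_nat_mult of_nat_numeral)
          hence "1 \<le> 4 / real m * real (card ?row + card ?col)"
            using \<open>0 < m\<close> by (simp add: field_simps)
          hence "real (card C1) * (1 + hit_potential m D' P') \<le> real (card C1) * hit_potential m D P"
            using drop by (intro mult_left_mono) auto
          moreover have "0 \<le> 4 / real m * real (card ?C)" by simp
          ultimately show ?thesis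
            by (simp only: distrib_left mult_1_right)
        qed
      qed
      have "real (card C2) * hit_potential m D' P
          \<le> real (card C2) * hit_potential m D P + 8 / real m * real (card C2)"
        using mult_left_mono[OF pot2, of "real (card C2)"] by (simp add: algebra_simps)
      also have "\<dots> \<le> real (card C2) * hit_potential m D P + 8 / real m * real (card ?C)"
        by (simp add: cardC divide_right_mono)
      finally have p2: "real (card C2) * hit_potential m D' P
          \<le> real (card C2) * hit_potential m D P + 8 / real m * real (card ?C)" .
      have "?F \<le> ?G + (real (card C1) * hit_potential m D P + real (card C2) * hit_potential m D P)"
        unfolding F G using IH1 IH2 pot1 p2 by (simp add: add_divide_distrib)
      thus ?thesis
        by (simp add: cardC distrib_right)
    qed
  qed
qed

text \<open>
  While at most \<open>h\<close> groups are revealed, \<open>card S\<close> is a constant plus a binomial variable on at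
  least \<open>G - h\<close> fair bits, so every fixed value of it has probability at most \<open>1 / sqrt (G - h)\<close>.
\<close>

lemma card_correct_bits_le:
  fixes w :: real and grp :: "nat \<Rightarrow> nat"
  assumes window: "\<And>r. real (card {k. k \<le> G \<and> Q r k}) \<le> w" and "h < G"
    and "V \<subseteq> {..<G}" "S0 \<subseteq> V"
  shows "real (card {S. S \<subseteq> {..<G} \<and> S \<inter> V = S0 \<and>
            Q (tree_output (edge \<sigma> (\<lambda>i. grp i \<in> S)) t) (card S) \<and>
            card (V \<union> (grp ` fst ` (graph_of \<sigma> \<inter> tree_reads (edge \<sigma> (\<lambda>i. grp i \<in> S)) t) \<inter> {..<G})) \<le> h})
         \<le> w / sqrt (real (G - h)) * 2 ^ (G - card V)"
  (is "real (card (?A t V S0)) \<le> _")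
  using assms(3,4)
\<comment> \<open>\<open>V\<close> holds the groups revealed so far, and \<open>S0\<close> those of
  them whose bit is set.\<close>
proof (induction t arbitrary: V S0)
  case (Leaf r)
  have "0 \<le> w"
    using window[of r] by (rule order_trans[rotated]) simp
  have finV: "finite V"
    using Leaf.prems(1) by (rule finite_subset) simp
  show ?case
  proof (cases "card V \<le> h")
    case False
    thus ?thesis using \<open>0 \<le> w\<close> by simp
  next
    case True
    let ?U = "{..<G} - V"
    have U: "card ?U = G - card V"
      using Leaf.prems(1) finV by (simp add: card_Diff_subset)
    let ?K = "{k. k \<le> G \<and> Q r k}"
    let ?B = "\<lambda>k. {S. S \<subseteq> {..<G} \<and> S \<inter> V = S0 \<and> card S = k}"
    have B: "real (card (?B k)) \<le> 2 ^ (G - card V) / sqrt (real (G - h))" for k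
    proof -
      \<comment> \<open>A set in \<open>?B k\<close> is determined by its part outside
        \<open>V\<close>, which has \<open>k - card S0\<close> elements.\<close>
      have "card (?B k) \<le> card {T. T \<subseteq> ?U \<and> card T = k - card S0}"
      proof (rule card_inj_on_le[where f = "\<lambda>S. S - V"])
        show "inj_on (\<lambda>S. S - V) (?B k)"
        proof (rule inj_onI)
          fix S T assume "S \<in> ?B k" "T \<in> ?B k" "S - V = T - V"
          thus "S = T" by blast
        qed
        show "(\<lambda>S. S - V) ` ?B k \<subseteq> {T. T \<subseteq> ?U \<and> card T = k - card S0}"
        proof (clarify, goal_cases)
          case (1 _ S)
          have "card (S - V) = card S - card (S \<inter> V)"
            using finV by (simp add: card_Diff_subset_Int)
          with 1 show ?case by auto
        qed
        show "finite {T. T \<subseteq> ?U \<and> card T = k - card S0}"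
          by (rule finite_subset[of _ "Pow {..<G}"]) auto
      qed
      also have "\<dots> = (G - card V) choose (k - card S0)"
        by (subst n_subsets) (simp_all add: U)
      finally have "real (card (?B k)) \<le> real ((G - card V) choose (k - card S0))"
        by (rule of_nat_mono)
      also have "\<dots> \<le> 2 ^ (G - card V) / sqrt (real (G - card V))"
        using True \<open>h < G\<close> by (intro binomial_le_power2_div_sqrt) simp
      also have "\<dots> \<le> 2 ^ (G - card V) / sqrt (real (G - h))"
        using True \<open>h < G\<close> by (intro divide_left_mono) auto
      finally show ?thesis .
    qed
    have "?A (Leaf r) V S0 \<subseteq> (\<Union>k\<in>?K. ?B k)"
    proof
      fix S assume S: "S \<in> ?A (Leaf r) V S0"
      hence *: "S \<subseteq> {..<G}" "S \<inter> V = S0" "Q r (card S)"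
        by simp_all
      hence "card S \<le> G"
        using card_mono[OF finite_lessThan *(1)] by simp
      have "card S \<in> ?K"
        by (intro CollectI conjI; fact)
      moreover have "S \<in> ?B (card S)"
        by (intro CollectI conjI; fact refl *)
      ultimately show "S \<in> (\<Union>k\<in>?K. ?B k)"
        by (rule UN_I)
    qed
    hence "card (?A (Leaf r) V S0) \<le> card (\<Union>k\<in>?K. ?B k)"
      by (intro card_mono finite_UN_I) (auto intro: finite_subset[of _ "Pow {..<G}"])
    also have "\<dots> \<le> (\<Sum>k\<in>?K. card (?B k))"
      by (rule card_UN_le) simp
    finally have "real (card (?A (Leaf r) V S0)) \<le> real (\<Sum>k\<in>?K. card (?B k))"
      by (rule of_nat_mono)
    also have "\<dots> = (\<Sum>k\<in>?K. real (card (?B k)))" by simp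
    also have "\<dots> \<le> real (card ?K) * (2 ^ (G - card V) / sqrt (real (G - h)))"
      using sum_mono[of ?K, OF B] by simp
    also have "\<dots> \<le> w * (2 ^ (G - card V) / sqrt (real (G - h)))"
      by (intro mult_right_mono window) auto
    finally show ?thesis by simp
  qed
next
  case (Node i j k)
  have finA: "finite (?A t V S0)" for t V S0
    by (rule finite_subset[of _ "Pow {..<G}"]) auto
  \<comment> \<open>A miss is answered negatively whatever the bits are. A hit in a revealed group
    is answered according to \<open>S0\<close>, and a hit at a vertex with
    \<open>G \<le> grp i\<close> negatively. Only a hit in a new group splits the bit sets in
    two.\<close>
  consider (miss) "\<sigma> i \<noteq> j" | (known) "\<sigma> i = j" "grp i \<in> V \<or> G \<le> grp i"
    | (new) "\<sigma> i = j" "grp i \<notin> V" "grp i < G" by linarith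
  thus ?case
  proof cases
    case miss
    hence "?A (Node i j k) V S0 = ?A (k False) V S0"
      by (simp add: edge_def graph_of_def)
    thus ?thesis using Node.IH[OF _ Node.prems] by simp
  next
    case known
    have "?A (Node i j k) V S0 = ?A (k (grp i \<in> S0)) V S0"
    proof (rule Collect_cong, goal_cases)
      case (1 S)
      show ?case
      proof (cases "S \<subseteq> {..<G} \<and> S \<inter> V = S0")
        case True
        hence "grp i \<in> S \<longleftrightarrow> grp i \<in> S0"
          using known \<open>S0 \<subseteq> V\<close> \<open>V \<subseteq> {..<G}\<close> by auto
        moreover have "V \<union> (grp ` fst ` (graph_of \<sigma> \<inter> insert (i, j) R) \<inter> {..<G})
            = V \<union> (grp ` fst ` (graph_of \<sigma> \<inter> R) \<inter> {..<G})" for R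
          using known by (auto simp: graph_of_def)
        ultimately show ?thesis
          using known by (simp add: edge_def)
      qed auto
    qed
    thus ?thesis using Node.IH[OF _ Node.prems] by simp
  next
    case new
    let ?V = "insert (grp i) V"
    have V: "?V \<subseteq> {..<G}" "S0 \<subseteq> ?V" "insert (grp i) S0 \<subseteq> ?V"
      using new Node.prems by auto
    have "?A (Node i j k) V S0 \<subseteq> ?A (k True) ?V (insert (grp i) S0) \<union> ?A (k False) ?V S0"
    proof (rule subsetI)
      fix S assume S: "S \<in> ?A (Node i j k) V S0"
      have S': "S \<inter> V = S0"
        using S by (simp only: mem_Collect_eq)
      have answer: "edge \<sigma> (\<lambda>i. grp i \<in> S) i j \<longleftrightarrow> grp i \<in> S"
        using new by (simp add: edge_def)
      have groups: "V \<union> (grp ` fst ` (graph_of \<sigma> \<inter> insert (i, j) R) \<inter> {..<G})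
          = ?V \<union> (grp ` fst ` (graph_of \<sigma> \<inter> R) \<inter> {..<G})" for R
        using new by (auto simp: graph_of_def)
      show "S \<in> ?A (k True) ?V (insert (grp i) S0) \<union> ?A (k False) ?V S0"
      proof (cases "grp i \<in> S")
        case True
        have "S \<inter> ?V = insert (grp i) S0"
          using S' True by auto
        moreover from S have "S \<subseteq> {..<G} \<and>
            Q (tree_output (edge \<sigma> (\<lambda>i. grp i \<in> S)) (k True)) (card S) \<and>
            card (?V \<union> (grp ` fst ` (graph_of \<sigma> \<inter> tree_reads (edge \<sigma> (\<lambda>i. grp i \<in> S)) (k True)) \<inter> {..<G})) \<le> h"
          by (simp only: mem_Collect_eq tree_output.simps tree_reads.simps answer groups True simp_thms)
        ultimately show ?thesis
          by (intro UnI1 CollectI) (simp only: simp_thms)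
      next
        case False
        have "S \<inter> ?V = S0"
          using S' False by auto
        moreover from S have "S \<subseteq> {..<G} \<and>
            Q (tree_output (edge \<sigma> (\<lambda>i. grp i \<in> S)) (k False)) (card S) \<and>
            card (?V \<union> (grp ` fst ` (graph_of \<sigma> \<inter> tree_reads (edge \<sigma> (\<lambda>i. grp i \<in> S)) (k False)) \<inter> {..<G})) \<le> h"
          by (simp only: mem_Collect_eq tree_output.simps tree_reads.simps answer groups False simp_thms)
        ultimately show ?thesis
          by (intro UnI2 CollectI) (simp only: simp_thms)
      qed
    qed
    hence "card (?A (Node i j k) V S0)
        \<le> card (?A (k True) ?V (insert (grp i) S0) \<union> ?A (k False) ?V S0)"
      using finA by (intro card_mono) auto
    also have "\<dots> \<le> card (?A (k True) ?V (insert (grp i) S0)) + card (?A (k False) ?V S0)"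
      by (rule card_Un_le)
    finally have "real (card (?A (Node i j k) V S0))
        \<le> real (card (?A (k True) ?V (insert (grp i) S0)) + card (?A (k False) ?V S0))"
      by (rule of_nat_mono)
    also have "\<dots> = real (card (?A (k True) ?V (insert (grp i) S0))) + real (card (?A (k False) ?V S0))"
      by (rule of_nat_add)
    also have "\<dots> \<le> w / sqrt (real (G - h)) * 2 ^ (G - card ?V)
        + w / sqrt (real (G - h)) * 2 ^ (G - card ?V)"
      by (intro add_mono Node.IH V) auto
    \<comment> \<open>Each branch has one hidden bit less, so the two bounds add up to the bound for
      \<open>V\<close>.\<close>
    also have "G - card V = Suc (G - card ?V)"
    proof -
      have "finite V"
        using Node.prems(1) by (rule finite_subset) simp
      moreover have "card ?V \<le> G"
        using card_mono[OF _ V(1)] by simp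
      ultimately show ?thesis using new by simp
    qed
    hence "w / sqrt (real (G - h)) * 2 ^ (G - card ?V) + w / sqrt (real (G - h)) * 2 ^ (G - card ?V)
        = w / sqrt (real (G - h)) * 2 ^ (G - card V)"
      by simp
    finally show ?thesis .
  qed
qed

text \<open>A correct run either hits at most \<open>h\<close> groups, which for fixed \<sigma> is
  bounded through the hidden bits, or makes more than \<open>h\<close> hits, which for fixed
  \<open>S\<close> is bounded by Markov's inequality and \<open>sum_hits_le\<close>. The truncation
  is at \<open>h + 1\<close>, so that the truncated count still detects more than \<open>h\<close>
  hits.\<close>

lemma card_correct_le:
  fixes w q :: real and grp :: "nat \<Rightarrow> nat"
  assumes "0 < m" "4 * (h + 1) \<le> m" "h < G" "tree_within m t"
    and window: "\<And>r. real (card {k. k \<le> G \<and> Q r k}) \<le> w"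
    and reads: "\<And>\<sigma> S. \<sigma> permutes {..<m} \<Longrightarrow> S \<subseteq> {..<G} \<Longrightarrow>
                  real (card (tree_reads (edge \<sigma> (\<lambda>i. grp i \<in> S)) t)) \<le> q"
  shows "real (card {(\<sigma>, S). \<sigma> permutes {..<m} \<and> S \<subseteq> {..<G} \<and>
            Q (tree_output (edge \<sigma> (\<lambda>i. grp i \<in> S)) t) (card S)})
         \<le> (w / sqrt (real (G - h)) + 12 * q / (real m * real (h + 1))) * (fact m * 2 ^ G)"
proof -
  let ?\<Pi> = "{\<sigma>. \<sigma> permutes {..<m}}"
  let ?R = "\<lambda>\<sigma> S. tree_reads (edge \<sigma> (\<lambda>i. grp i \<in> S)) t"
  \<comment> \<open>The trivial terms with \<open>{}\<close> give this set the shape of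
    \<open>card_correct_bits_le\<close> at \<open>V = S0 = {}\<close>.\<close>
  let ?A = "\<lambda>\<sigma>. {S. S \<subseteq> {..<G} \<and> S \<inter> {} = {} \<and>
            Q (tree_output (edge \<sigma> (\<lambda>i. grp i \<in> S)) t) (card S) \<and>
            card ({} \<union> (grp ` fst ` (graph_of \<sigma> \<inter> ?R \<sigma> S) \<inter> {..<G})) \<le> h}"
  let ?B = "\<lambda>S. {\<sigma>. \<sigma> permutes {..<m} \<and> h < card (graph_of \<sigma> \<inter> ?R \<sigma> S)}"
  have fin: "finite ?\<Pi>" and card\<Pi>: "card ?\<Pi> = fact m"
    by (simp_all add: finite_permutations card_permutations)
  have finA: "finite (?A \<sigma>)" for \<sigma>
    by (rule finite_subset[of _ "Pow {..<G}"]) auto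
  have finB: "finite (?B S)" for S
    by (rule finite_subset[OF _ fin]) auto
  have A: "real (card (?A \<sigma>)) \<le> w / sqrt (real (G - h)) * 2 ^ G" for \<sigma>
    using card_correct_bits_le[OF window \<open>h < G\<close> empty_subsetI empty_subsetI,
        where \<sigma> = \<sigma> and grp = grp and t = t]
    by (simp only: card.empty diff_zero)
  have B: "real (card (?B S)) \<le> 12 * q / (real m * real (h + 1)) * fact m" if "S \<subseteq> {..<G}" for S
  proof -
    have C: "consistent_perms m {} {} = ?\<Pi>"
      by (simp add: consistent_perms_def)
    have "real (h + 1) * real (card (?B S)) = (\<Sum>\<sigma>\<in>?B S. real (h + 1))" by simp
    also have "\<dots> \<le> (\<Sum>\<sigma>\<in>?B S. real (min (h + 1) (card (graph_of \<sigma> \<inter> ?R \<sigma> S))))"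
      by (intro sum_mono) auto
    also have "\<dots> \<le> (\<Sum>\<sigma>\<in>?\<Pi>. real (min (h + 1) (card (graph_of \<sigma> \<inter> ?R \<sigma> S))))"
      using fin by (intro sum_mono2) auto
    also have "\<dots> \<le> (\<Sum>\<sigma>\<in>?\<Pi>. 12 / real m * real (card (?R \<sigma> S)))"
      using sum_hits_le[OF assms(1,2,4), of "{}" "{}" "\<lambda>i. grp i \<in> S"]
      by (simp add: C hit_potential_def)
    also have "\<dots> \<le> (\<Sum>\<sigma>\<in>?\<Pi>. 12 / real m * q)"
      using reads that by (intro sum_mono mult_left_mono) auto
    also have "\<dots> = fact m * (12 / real m * q)"
      by (simp add: card\<Pi>)
    finally have "real (card (?B S)) * real (h + 1) \<le> fact m * (12 / real m * q)"
      by (simp only: mult.commute)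
    moreover have "0 < real (h + 1)" by simp
    ultimately have "real (card (?B S)) \<le> fact m * (12 / real m * q) / real (h + 1)"
      by (simp only: pos_le_divide_eq)
    thus ?thesis
      by (simp only: times_divide_eq_left times_divide_eq_right divide_divide_eq_left mult_ac)
  qed
  \<comment> \<open>The second set on the right fixes \<open>S\<close> first and lets \<sigma> vary,
    hence the swap of coordinates.\<close>
  have "{(\<sigma>, S). \<sigma> permutes {..<m} \<and> S \<subseteq> {..<G} \<and>
            Q (tree_output (edge \<sigma> (\<lambda>i. grp i \<in> S)) t) (card S)}
      \<subseteq> Sigma ?\<Pi> ?A \<union> prod.swap ` Sigma (Pow {..<G}) ?B" (is "?L \<subseteq> _")
  proof (clarify, goal_cases)
    case (1 \<sigma> S)
    have "card (grp ` fst ` (graph_of \<sigma> \<inter> ?R \<sigma> S) \<inter> {..<G}) \<le> card (graph_of \<sigma> \<inter> ?R \<sigma> S)"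
      by (rule order_trans[OF card_mono[OF _ Int_lower1]])
         (auto simp: finite_tree_reads image_image intro: card_image_le)
    with 1 show ?case by (force simp: image_iff)
  qed
  hence "card ?L \<le> card (Sigma ?\<Pi> ?A \<union> prod.swap ` Sigma (Pow {..<G}) ?B)"
    using fin finA finB by (intro card_mono) auto
  also have "\<dots> \<le> card (Sigma ?\<Pi> ?A) + card (Sigma (Pow {..<G}) ?B)"
    by (rule order_trans[OF card_Un_le]) (simp add: card_image)
  also have "\<dots> = (\<Sum>\<sigma>\<in>?\<Pi>. card (?A \<sigma>)) + (\<Sum>S\<in>Pow {..<G}. card (?B S))"
    by (intro arg_cong2[of _ _ _ _ "(+)"] card_SigmaI fin ballI finA finB) simp
  finally have "real (card ?L) \<le> real ((\<Sum>\<sigma>\<in>?\<Pi>. card (?A \<sigma>)) + (\<Sum>S\<in>Pow {..<G}. card (?B S)))"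
    by (rule of_nat_mono)
  also have "\<dots> = (\<Sum>\<sigma>\<in>?\<Pi>. real (card (?A \<sigma>))) + (\<Sum>S\<in>Pow {..<G}. real (card (?B S)))"
    by simp
  also have "\<dots> \<le> (\<Sum>\<sigma>\<in>?\<Pi>. w / sqrt (real (G - h)) * 2 ^ G)
      + (\<Sum>S\<in>Pow {..<G}. 12 * q / (real m * real (h + 1)) * fact m)"
    using A B by (intro add_mono sum_mono) auto
  also have "\<dots> = (w / sqrt (real (G - h)) + 12 * q / (real m * real (h + 1))) * (fact m * 2 ^ G)"
    by (simp add: card\<Pi> card_Pow algebra_simps)
  finally show ?thesis .
qed

section \<open>Hard input matrices\<close>

lemma output_on_cong:
  assumes "\<And>i j. (i, j) \<in> entries_read A t \<Longrightarrow> B $$ (i, j) = A $$ (i, j)"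
  shows "output_on B t = output_on A t"
  using assms by (induction t) auto

lemma finite_entries_read: "finite (entries_read A t)"
  by (induction t) auto

lemma frobenius_norm_power2:
  "(frobenius_norm A)\<^sup>2 = (\<Sum>i<dim_row A. \<Sum>j<dim_col A. (A $$ (i, j))\<^sup>2)"
  by (simp add: frobenius_norm_def sum_nonneg)

lemma psd_matI:
  assumes "A \<in> carrier_mat n n"
    and "\<And>i j. i < n \<Longrightarrow> j < n \<Longrightarrow> A $$ (i, j) = A $$ (j, i)"
    and "\<And>x. 0 \<le> (\<Sum>i<n. \<Sum>j<n. A $$ (i, j) * (x i * x j))"
  shows "psd_mat n A"
proof -
  have "scalar_prod x (A *\<^sub>v x) = (\<Sum>i<n. \<Sum>j<n. A $$ (i, j) * (x $ i * x $ j))"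
    if "x \<in> carrier_vec n" for x
    using assms(1) that
    by (auto simp: scalar_prod_def atLeast0LessThan sum_distrib_left mult_ac intro!: sum.cong)
  moreover have "transpose_mat A = A"
    using assms(1,2) by (intro eq_matI) auto
  ultimately show ?thesis
    using assms(1,3) by (simp add: psd_mat_def)
qed

section \<open>A hidden diagonal entry and the linear bound\<close>

definition spike_mat :: "nat \<Rightarrow> nat \<Rightarrow> real mat" where
  "spike_mat n x = mat n n (\<lambda>(i, j). if i \<noteq> j then 0 else if i = 0 then 1 else if i = x then 2 else 0)"

lemma dim_spike_mat [simp]: "dim_row (spike_mat n x) = n" "dim_col (spike_mat n x) = n"
  by (simp_all add: spike_mat_def)

text \<open>An arbitrary \<open>f\<close> that vanishes at entry 0 covers both the quadratic form
  and the squared norm.\<close>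

lemma sum_spike_mat:
  fixes f :: "real \<Rightarrow> nat \<Rightarrow> nat \<Rightarrow> real"
  assumes "0 < n" "x < n" "\<And>i j. f 0 i j = 0"
  shows "(\<Sum>i<n. \<Sum>j<n. f (spike_mat n x $$ (i, j)) i j) = f 1 0 0 + (if 0 < x then f 2 x x else 0)"
proof -
  have "(\<Sum>i<n. \<Sum>j<n. f (spike_mat n x $$ (i, j)) i j)
      = (\<Sum>i<n. \<Sum>j<n. if j = i then f (if i = 0 then 1 else if i = x then 2 else 0) i i else 0)"
    using assms(3) by (intro sum.cong refl) (auto simp: spike_mat_def)
  also have "\<dots> = (\<Sum>i<n. f (if i = 0 then 1 else if i = x then 2 else 0) i i)"
    by (intro sum.cong refl) simp
  also have "\<dots> = (\<Sum>i<n. (if i = 0 then f 1 0 0 else 0) + (if i = x then (if 0 < x then f 2 x x else 0) else 0))"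
    using assms(3) by (intro sum.cong refl) auto
  also have "\<dots> = f 1 0 0 + (if 0 < x then f 2 x x else 0)"
    using assms(1,2) by (simp only: sum.distrib) simp
  finally show ?thesis .
qed

lemma psd_spike_mat:
  assumes "0 < n" "x < n"
  shows "psd_mat n (spike_mat n x)"
proof (rule psd_matI)
  show "0 \<le> (\<Sum>i<n. \<Sum>j<n. spike_mat n x $$ (i, j) * (y i * y j))" for y
    using sum_spike_mat[OF assms, of "\<lambda>a i j. a * (y i * y j)"] by simp
qed (auto simp: spike_mat_def)

lemma frobenius_spike_mat:
  assumes "0 < n" "x < n"
  shows "(frobenius_norm (spike_mat n x))\<^sup>2 = (if 0 < x then 5 else 1)"
  using sum_spike_mat[OF assms, of "\<lambda>a i j. a\<^sup>2"]
  by (simp add: frobenius_norm_power2)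

lemma spike_mat_nonzero:
  assumes "0 < n"
  shows "spike_mat n x \<noteq> 0\<^sub>m n n"
proof -
  have "spike_mat n x $$ (0, 0) \<noteq> 0\<^sub>m n n $$ (0, 0)"
    using assms by (simp add: spike_mat_def)
  thus ?thesis by metis
qed

definition approximates :: "real \<Rightarrow> real \<Rightarrow> real \<Rightarrow> bool" where
  "approximates \<epsilon> F r \<longleftrightarrow> (1 - \<epsilon>) * F \<le> r \<and> r \<le> (1 + \<epsilon>) * F"

text \<open>Yao's principle: it remains to find a finite family of inputs on which no deterministic
  algorithm with few reads is correct for two thirds of the family.\<close>

lemma deterministic_alg_good_on_average:
  fixes A :: "'i \<Rightarrow> real mat"
  assumes alg: "randomized_query_alg n M" "estimates_frobenius_sq n \<epsilon> M" and "finite I"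
    and A: "\<And>y. y \<in> I \<Longrightarrow> psd_mat n (A y)" "\<And>y. y \<in> I \<Longrightarrow> A y \<noteq> 0\<^sub>m n n"
  obtains t where "t \<in> space M" "queries_within n t"
    "2 / 3 * real (card I)
       \<le> real (card {y \<in> I. approximates \<epsilon> ((frobenius_norm (A y))\<^sup>2) (output_on (A y) t)})"
proof -
  let ?good = "\<lambda>y. {t \<in> space M. approximates \<epsilon> ((frobenius_norm (A y))\<^sup>2) (output_on (A y) t)}"
  have good: "?good y \<in> sets M" "2 / 3 \<le> measure M (?good y)" if "y \<in> I" for y
    using alg(2) A[OF that] unfolding estimates_frobenius_sq_def Let_def approximates_def by blast+
  have M: "prob_space M" "\<And>t. t \<in> space M \<Longrightarrow> queries_within n t"
    using alg(1) by (simp_all add: randomized_query_alg_def)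
  obtain t where t: "t \<in> space M" "2 / 3 * real (card I) \<le> real (card {y \<in> I. t \<in> ?good y})"
    by (rule exists_good_on_average[OF M(1) \<open>finite I\<close> good])
  moreover have "{y \<in> I. t \<in> ?good y}
      = {y \<in> I. approximates \<epsilon> ((frobenius_norm (A y))\<^sup>2) (output_on (A y) t)}"
    using t(1) by auto
  ultimately show ?thesis
    using that M(2) by simp
qed

text \<open>If the run on the matrix without a spike does not read position \<open>(x, x)\<close>,
  the output is the same with a spike at \<open>x\<close>, and it is wrong in one of the two
  cases.\<close>

lemma linear_lower_bound:
  assumes "4 \<le> n" "0 < \<epsilon>" "\<epsilon> < 1 / 2"
    and alg: "randomized_query_alg n M" "estimates_frobenius_sq n \<epsilon> M"
  shows "\<exists>A. psd_mat n A \<and> A \<noteq> 0\<^sub>m n n \<and>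
           (\<exists>t \<in> space M. real n / 4 \<le> real (card (entries_read A t)))"
proof (rule ccontr)
  assume *: "\<not> ?thesis"
  have few: "real (card (entries_read A t)) < real n / 4"
    if "psd_mat n A" "A \<noteq> 0\<^sub>m n n" "t \<in> space M" for A t
    using * that by (meson not_less)
  \<comment> \<open>\<open>spike_mat n 0\<close> has no spike, and its 1 at the origin keeps it
    nonzero. The index pairs count this matrix once per spike position, so both kinds of input have
    equal weight.\<close>
  let ?A = "\<lambda>(b, x). spike_mat n (if b then x else 0)"
  let ?I = "UNIV \<times> {1..<n} :: (bool \<times> nat) set"
  let ?ok = "\<lambda>t y. approximates \<epsilon> ((frobenius_norm (?A y))\<^sup>2) (output_on (?A y) t)"
  have A: "psd_mat n (?A y)" "?A y \<noteq> 0\<^sub>m n n" if "y \<in> ?I" for y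
    using that \<open>4 \<le> n\<close> by (auto simp: psd_spike_mat spike_mat_nonzero)
  have finI: "finite ?I" by simp
  obtain t where t: "t \<in> space M" and within: "queries_within n t"
    and often: "2 / 3 * real (card ?I) \<le> real (card {y \<in> ?I. ?ok t y})"
    by (rule deterministic_alg_good_on_average[OF alg finI A])
  define C where "C b = {x \<in> {1..<n}. ?ok t (b, x)}" for b
  have finC: "finite (C b)" for b
    by (simp add: C_def)
  have "{y \<in> ?I. ?ok t y} = Pair False ` C False \<union> Pair True ` C True"
    by (auto simp: C_def image_iff split: if_splits)
  hence "card {y \<in> ?I. ?ok t y} \<le> card (C False) + card (C True)"
    using finC by (simp add: card_Un_disjoint card_image inj_on_def image_iff disjoint_iff)
  also have "\<dots> = card (C False \<union> C True) + card (C False \<inter> C True)"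
    by (rule card_Un_Int) (rule finC)+
  also have "\<dots> \<le> (n - 1) + card (entries_read (spike_mat n 0) t)"
  proof (intro add_mono)
    show "card (C False \<union> C True) \<le> n - 1"
    proof -
      have "C False \<union> C True \<subseteq> {1..<n}"
        by (auto simp: C_def)
      from card_mono[OF _ this] show ?thesis by simp
    qed
    have "(x, x) \<in> entries_read (spike_mat n 0) t" if x: "x \<in> C False" "x \<in> C True" for x
    proof (rule ccontr)
      assume nr: "(x, x) \<notin> entries_read (spike_mat n 0) t"
      have "entries_read (spike_mat n 0) t \<subseteq> {..<n} \<times> {..<n}"
        using within by (induction t) auto
      hence "output_on (spike_mat n x) t = output_on (spike_mat n 0) t"
        using nr by (intro output_on_cong) (auto simp: spike_mat_def)
      \<comment> \<open>The two outputs agree, yet one is below \<open>3 / 2\<close> and the other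
        above \<open>5 / 2\<close>.\<close>
      moreover have "output_on (spike_mat n 0) t \<le> (1 + \<epsilon>) * 1"
        and "(1 - \<epsilon>) * 5 \<le> output_on (spike_mat n x) t"
        using x \<open>4 \<le> n\<close> by (auto simp: C_def frobenius_spike_mat approximates_def)
      ultimately show False
        using \<open>\<epsilon> < 1 / 2\<close> by simp
    qed
    thus "card (C False \<inter> C True) \<le> card (entries_read (spike_mat n 0) t)"
      by (intro card_inj_on_le[of "\<lambda>x. (x, x)"] inj_onI) (auto simp: finite_entries_read)
  qed
  finally have "real (card {y \<in> ?I. ?ok t y})
      \<le> real (n - 1) + real (card (entries_read (spike_mat n 0) t))"
    by linarith
  also have "\<dots> < real (n - 1) + real n / 4"
    using few[OF _ _ t, of "spike_mat n 0"] \<open>4 \<le> n\<close>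
    by (simp add: psd_spike_mat spike_mat_nonzero)
  \<comment> \<open>Together with \<open>often\<close> this would give
    \<open>4 / 3 * (n - 1) < n - 1 + n / 4\<close>, that is \<open>n < 4\<close>.\<close>
  finally show False
    using often \<open>4 \<le> n\<close> by (simp add: card_cartesian_product of_nat_diff)
qed

section \<open>Matrices of hidden matchings\<close>

definition matching_mat :: "nat \<Rightarrow> nat \<Rightarrow> (nat \<Rightarrow> nat) \<Rightarrow> (nat \<Rightarrow> bool) \<Rightarrow> real mat" where
  "matching_mat m n \<sigma> b =
     mat n n (\<lambda>(p, q). of_bool (p = q \<or> (p < m \<and> q = m + \<sigma> p \<and> b p) \<or> (q < m \<and> p = m + \<sigma> q \<and> b q)))"

lemma dim_matching_mat [simp]:
  "dim_row (matching_mat m n \<sigma> b) = n" "dim_col (matching_mat m n \<sigma> b) = n"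
  by (simp_all add: matching_mat_def)

text \<open>The three conditions exclude each other, so the disjunction becomes a sum, along which
  double sums can be split.\<close>

lemma matching_mat_index:
  assumes "p < n" "q < n"
  shows "matching_mat m n \<sigma> b $$ (p, q) = of_bool (p = q)
     + of_bool (p < m \<and> q = m + \<sigma> p \<and> b p)
     + of_bool (q < m \<and> p = m + \<sigma> q \<and> b q)"
  using assms by (auto simp: matching_mat_def)

lemma sum_matching_mat:
  fixes f :: "nat \<Rightarrow> nat \<Rightarrow> real"
  assumes \<sigma>: "\<sigma> permutes {..<m}" and mn: "2 * m \<le> n"
  shows "(\<Sum>p<n. \<Sum>q<n. matching_mat m n \<sigma> b $$ (p, q) * f p q) =
     (\<Sum>p<n. f p p) +
     (\<Sum>p | p < m \<and> b p. f p (m + \<sigma> p) + f (m + \<sigma> p) p)"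
proof -
  have half: "(\<Sum>p<n. \<Sum>q<n. of_bool (p < m \<and> q = m + \<sigma> p \<and> b p) * g p q)
      = (\<Sum>p | p < m \<and> b p. g p (m + \<sigma> p))" for g :: "nat \<Rightarrow> nat \<Rightarrow> real"
  proof -
    have "(\<Sum>q<n. of_bool (p < m \<and> q = m + \<sigma> p \<and> b p) * g p q)
        = (if p < m \<and> b p then g p (m + \<sigma> p) else 0)" for p
    proof (cases "p < m \<and> b p")
      case True
      hence "\<sigma> p < m"
        using permutes_in_image[OF \<sigma>, of p] by simp
      hence "m + \<sigma> p < n" using mn by linarith
      with True show ?thesis
        by (simp add: of_bool_def if_distrib[of "\<lambda>c. c * _"] cong: if_cong)
    qed auto
    moreover have "{..<n} \<inter> {p. p < m \<and> b p} = {p. p < m \<and> b p}"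
    using mn by auto
    ultimately show ?thesis
      by (simp add: sum.If_cases)
  qed
  have "(\<Sum>p<n. \<Sum>q<n. matching_mat m n \<sigma> b $$ (p, q) * f p q)
      = (\<Sum>p<n. \<Sum>q<n. of_bool (p = q) * f p q)
      + (\<Sum>p<n. \<Sum>q<n. of_bool (p < m \<and> q = m + \<sigma> p \<and> b p) * f p q)
      + (\<Sum>p<n. \<Sum>q<n. of_bool (q < m \<and> p = m + \<sigma> q \<and> b q) * f p q)"
    by (simp add: matching_mat_index distrib_right sum.distrib)
  also have "(\<Sum>p<n. \<Sum>q<n. of_bool (q < m \<and> p = m + \<sigma> q \<and> b q) * f p q)
      = (\<Sum>q<n. \<Sum>p<n. of_bool (q < m \<and> p = m + \<sigma> q \<and> b q) * f p q)"
    by (rule sum.swap)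
  also have "\<dots> = (\<Sum>q | q < m \<and> b q. f (m + \<sigma> q) q)"
    by (rule half)
  also have "(\<Sum>p<n. \<Sum>q<n. of_bool (p = q) * f p q) = (\<Sum>p<n. f p p)"
    by (intro sum.cong refl) (simp add: of_bool_def if_distrib[of "\<lambda>c. c * _"] cong: if_cong)
  finally show ?thesis
    by (simp only: half sum.distrib add.assoc)
qed

text \<open>The quadratic form is the sum of all squares plus twice the product of the end values of
  each edge. As the edges are disjoint, the squares at their ends are part of the sum of all squares
  and complete each product to the square of a sum.\<close>

lemma psd_matching_mat:
  assumes \<sigma>: "\<sigma> permutes {..<m}" and mn: "2 * m \<le> n"
  shows "psd_mat n (matching_mat m n \<sigma> b)"
proof (rule psd_matI)
  show "matching_mat m n \<sigma> b \<in> carrier_mat n n"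
    by (simp add: matching_mat_def)
  show "matching_mat m n \<sigma> b $$ (p, q) = matching_mat m n \<sigma> b $$ (q, p)" if "p < n" "q < n" for p q
    using that by (auto simp: matching_mat_index)
  fix x :: "nat \<Rightarrow> real"
  let ?B = "{p. p < m \<and> b p}"
  have "(\<Sum>p\<in>?B. (x p)\<^sup>2 + (x (m + \<sigma> p))\<^sup>2) \<le> (\<Sum>p<m. (x p)\<^sup>2 + (x (m + \<sigma> p))\<^sup>2)"
    by (intro sum_mono2) auto
  also have "\<dots> = (\<Sum>p<m. (x p)\<^sup>2) + (\<Sum>p<m. (x (m + p))\<^sup>2)"
    using sum.permute[OF \<sigma>, of "\<lambda>p. (x (m + p))\<^sup>2"] by (simp add: sum.distrib o_def)
  also have "\<dots> = (\<Sum>p<m + m. (x p)\<^sup>2)"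
  proof -
    have "(\<Sum>p<m + m. (x p)\<^sup>2) = (\<Sum>p\<in>{..<m} \<union> (+) m ` {..<m}. (x p)\<^sup>2)"
    proof (rule sum.cong)
      show "{..<m + m} = {..<m} \<union> (+) m ` {..<m}"
        by (simp add: lessThan_atLeast0 ivl_disj_un)
    qed simp
    also have "\<dots> = (\<Sum>p<m. (x p)\<^sup>2) + (\<Sum>p\<in>(+) m ` {..<m}. (x p)\<^sup>2)"
      by (rule sum.union_disjoint) auto
    finally show ?thesis
      by (simp add: sum.reindex inj_on_def)
  qed
  also have "\<dots> \<le> (\<Sum>p<n. (x p)\<^sup>2)"
    using mn by (intro sum_mono2) auto
  finally have "(\<Sum>p\<in>?B. (x p)\<^sup>2 + (x (m + \<sigma> p))\<^sup>2) \<le> (\<Sum>p<n. (x p)\<^sup>2)" .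
  moreover have "0 \<le> (\<Sum>p\<in>?B. (x p + x (m + \<sigma> p))\<^sup>2)"
    by (intro sum_nonneg) auto
  moreover have "(\<Sum>p\<in>?B. (x p + x (m + \<sigma> p))\<^sup>2) = (\<Sum>p\<in>?B. (x p)\<^sup>2 + (x (m + \<sigma> p))\<^sup>2)
      + (\<Sum>p\<in>?B. x p * x (m + \<sigma> p) + x (m + \<sigma> p) * x p)"
    by (simp add: power2_sum sum.distrib [symmetric] algebra_simps)
  ultimately show "0 \<le> (\<Sum>p<n. \<Sum>q<n. matching_mat m n \<sigma> b $$ (p, q) * (x p * x q))"
    unfolding sum_matching_mat[OF \<sigma> mn, of b "\<lambda>p q. x p * x q"] by (simp add: power2_eq_square)
qed

lemma frobenius_matching_mat:
  assumes \<sigma>: "\<sigma> permutes {..<m}" and mn: "2 * m \<le> n"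
  shows "(frobenius_norm (matching_mat m n \<sigma> b))\<^sup>2 = real n + 2 * real (card {p. p < m \<and> b p})"
proof -
  \<comment> \<open>Entries are 0 or 1 and hence equal to their squares.\<close>
  have "(matching_mat m n \<sigma> b $$ (p, q))\<^sup>2 = matching_mat m n \<sigma> b $$ (p, q) * 1"
    if "p < n" "q < n" for p q
    using that by (simp add: matching_mat_def of_bool_def)
  hence "(frobenius_norm (matching_mat m n \<sigma> b))\<^sup>2 = (\<Sum>p<n. \<Sum>q<n. matching_mat m n \<sigma> b $$ (p, q) * 1)"
    by (simp add: frobenius_norm_power2)
  also have "\<dots> = real n + 2 * real (card {p. p < m \<and> b p})"
    by (subst sum_matching_mat[OF \<sigma> mn]) simp
  finally show ?thesis .
qed

lemma matching_mat_nonzero: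
  assumes "0 < n"
  shows "matching_mat m n \<sigma> b \<noteq> 0\<^sub>m n n"
proof -
  have "matching_mat m n \<sigma> b $$ (0, 0) \<noteq> 0\<^sub>m n n $$ (0, 0)"
    using assms by (simp add: matching_mat_def)
  thus ?thesis by metis
qed

text \<open>
  Entries \<open>(i, m + j)\<close> and \<open>(m + j, i)\<close> both ask for the pair \<open>(i, j)\<close>; all other entries of
  \<open>matching_mat\<close> are known in advance.
\<close>

primrec to_tree :: "nat \<Rightarrow> query_alg \<Rightarrow> bool_tree" where
  "to_tree m (Output r) = Leaf r"
| "to_tree m (Query p q k) =
    (if p < m \<and> m \<le> q \<and> q < 2 * m then Node p (q - m) (\<lambda>a. to_tree m (k (of_bool a)))
     else if q < m \<and> m \<le> p \<and> p < 2 * m then Node q (p - m) (\<lambda>a. to_tree m (k (of_bool a)))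
     else to_tree m (k (of_bool (p = q))))"

lemma tree_within_to_tree: "tree_within m (to_tree m t)"
  by (induction t) auto

text \<open>The map folds both positions of a pair onto that pair. Reads of entries known in advance
  have no counterpart in the tree, so the second claim is only an inclusion.\<close>

lemma to_tree_matching_mat:
  assumes \<sigma>: "\<sigma> permutes {..<m}" and mn: "2 * m \<le> n" and "queries_within n t"
  shows "tree_output (edge \<sigma> b) (to_tree m t) = output_on (matching_mat m n \<sigma> b) t"
    and "tree_reads (edge \<sigma> b) (to_tree m t)
       \<subseteq> (\<lambda>(p, q). if p < m then (p, q - m) else (q, p - m)) `
          entries_read (matching_mat m n \<sigma> b) t"
  using assms(3)
proof (induction t)
  case (Output r)
  { case 1 show ?case by simp }
  { case 2 show ?case by simp }
next
  case (Query p q k)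
  let ?A = "matching_mat m n \<sigma> b"
  have bnd: "\<sigma> i < m" if "i < m" for i
    using permutes_in_image[OF \<sigma>, of i] that by simp
  let ?up = "p < m \<and> m \<le> q \<and> q < 2 * m" and ?low = "q < m \<and> m \<le> p \<and> p < 2 * m"
  let ?a = "?A $$ (p, q)"
  let ?f = "\<lambda>(p, q). if p < m then (p, q - m) else (q, p - m)"
  have entry: "?a = of_bool (p = q \<or> (p < m \<and> q = m + \<sigma> p \<and> b p) \<or> (q < m \<and> p = m + \<sigma> q \<and> b q))"
    if "p < n" "q < n"
    using that by (simp only: matching_mat_def index_mat case_prod_conv)
  have up: "?a = of_bool (edge \<sigma> b p (q - m))" if "p < n" "q < n" ?up
  proof -
    have "p \<noteq> q" "\<not> q < m" "q = m + \<sigma> p \<longleftrightarrow> \<sigma> p = q - m"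
      using that(3) by linarith+
    thus ?thesis
      using that by (simp add: entry edge_def)
  qed
  have low: "?a = of_bool (edge \<sigma> b q (p - m))" if "p < n" "q < n" ?low
  proof -
    have "p \<noteq> q" "\<not> p < m" "p = m + \<sigma> q \<longleftrightarrow> \<sigma> q = p - m"
      using that(3) by linarith+
    thus ?thesis
      using that by (simp add: entry edge_def)
  qed
  have other: "?a = of_bool (p = q)" if "p < n" "q < n" "\<not> ?up" "\<not> ?low"
  proof -
    have "\<not> (p < m \<and> q = m + \<sigma> p)" "\<not> (q < m \<and> p = m + \<sigma> q)"
      using that(3,4) bnd[of p] bnd[of q] by linarith+
    thus ?thesis
      using that by (auto simp: entry)
  qed
  consider ?up | "\<not> ?up" ?low | "\<not> ?up" "\<not> ?low" by blast
  note cases = this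
  { case 1
    hence "p < n" "q < n" and IH: "tree_output (edge \<sigma> b) (to_tree m (k ?a)) = output_on ?A (k ?a)"
      using Query.IH(1) by auto
    from cases show ?case
    proof cases
      case 1
      with up[OF \<open>p < n\<close> \<open>q < n\<close>] IH show ?thesis by (simp only: to_tree.simps tree_output.simps output_on.simps if_True simp_thms)
    next
      case 2
      with low[OF \<open>p < n\<close> \<open>q < n\<close>] IH show ?thesis by (simp only: to_tree.simps tree_output.simps output_on.simps if_True if_False simp_thms)
    next
      case 3
      with other[OF \<open>p < n\<close> \<open>q < n\<close>] IH show ?thesis by (simp only: to_tree.simps tree_output.simps output_on.simps if_False simp_thms)
    qed }
  { case 2
    hence "p < n" "q < n"
      and IH: "tree_reads (edge \<sigma> b) (to_tree m (k ?a)) \<subseteq> ?f ` entries_read ?A (k ?a)"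
      using Query.IH(2) by auto
    from cases show ?case
    proof cases
      case 1
      hence "tree_reads (edge \<sigma> b) (to_tree m (Query p q k))
          = insert (?f (p, q)) (tree_reads (edge \<sigma> b) (to_tree m (k ?a)))"
        by (simp add: up[OF \<open>p < n\<close> \<open>q < n\<close>])
      thus ?thesis
        using IH by (simp only: entries_read.simps image_insert) (rule insert_mono)
    next
      case 2
      hence "tree_reads (edge \<sigma> b) (to_tree m (Query p q k))
          = insert (?f (p, q)) (tree_reads (edge \<sigma> b) (to_tree m (k ?a)))"
        by (simp add: low[OF \<open>p < n\<close> \<open>q < n\<close>])
      thus ?thesis
        using IH by (simp only: entries_read.simps image_insert) (rule insert_mono)
    next
      case 3
      hence "tree_reads (edge \<sigma> b) (to_tree m (Query p q k))
          = tree_reads (edge \<sigma> b) (to_tree m (k ?a))"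
        using other[OF \<open>p < n\<close> \<open>q < n\<close> 3] by (simp only: to_tree.simps if_False)
      thus ?thesis
        using IH by (simp only: entries_read.simps image_insert) (rule subset_insertI2)
    qed }
qed

lemma card_to_tree_reads_le:
  assumes "\<sigma> permutes {..<m}" "2 * m \<le> n" "queries_within n t"
  shows "card (tree_reads (edge \<sigma> b) (to_tree m t)) \<le> card (entries_read (matching_mat m n \<sigma> b) t)"
  by (rule order_trans[OF card_mono[OF _ to_tree_matching_mat(2)[OF assms]]])
     (auto intro: card_image_le simp: finite_entries_read)

section \<open>Counting group numbers and vertices\<close>

lemma card_le_diameter:
  fixes K :: "nat set" and d :: real
  assumes "finite K" "0 \<le> d" "\<And>a b. a \<in> K \<Longrightarrow> b \<in> K \<Longrightarrow> a \<le> b \<Longrightarrow> real b - real a \<le> d"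
  shows "real (card K) \<le> d + 1"
proof (cases "K = {}")
  case True
  thus ?thesis using \<open>0 \<le> d\<close> by simp
next
  case False
  have "Min K \<le> Max K"
    using assms(1) False by simp
  have "card K \<le> card {Min K..Max K}"
    using assms(1) by (intro card_mono) auto
  hence "real (card K) \<le> real (Max K) - real (Min K) + 1"
    using \<open>Min K \<le> Max K\<close> by simp
  moreover have "real (Max K) - real (Min K) \<le> d"
    using assms(1,3) False \<open>Min K \<le> Max K\<close> by simp
  ultimately show ?thesis by linarith
qed

text \<open>Group \<open>s\<close> is the block of \<open>g\<close> consecutive vertices starting at
  \<open>s * g\<close>. The vertices from \<open>g * G\<close> on have quotient at least
  \<open>G\<close>, so they lie in no group and never have an edge.\<close>

lemma card_blocks:
  assumes "S \<subseteq> {..<G}" "g * G \<le> m" "0 < g"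
  shows "card {p. p < m \<and> p div g \<in> S} = g * card S"
proof -
  have "finite S"
    using assms(1) by (rule finite_subset) simp
  have "bij_betw (\<lambda>(s, r). s * g + r) (S \<times> {..<g}) {p. p < m \<and> p div g \<in> S}"
  proof (rule bij_betw_byWitness[where f' = "\<lambda>p. (p div g, p mod g)"])
    have "s * g + r < m" if "s \<in> S" "r < g" for s r
    proof -
      have "s * g + r < Suc s * g"
        using that by simp
      also have "\<dots> \<le> G * g"
        using that assms(1) by (intro mult_right_mono) auto
      finally show ?thesis
        using assms(2) by (simp add: mult.commute)
    qed
    thus "(\<lambda>(s, r). s * g + r) ` (S \<times> {..<g}) \<subseteq> {p. p < m \<and> p div g \<in> S}"
      by auto
  qed (use assms(3) in auto)
  hence "card {p. p < m \<and> p div g \<in> S} = card (S \<times> {..<g})"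
    by (rule bij_betw_same_card[symmetric])
  thus ?thesis
    using \<open>finite S\<close> by (simp add: card_cartesian_product mult.commute)
qed

section \<open>The lower bound\<close>

text \<open>If \<open>r\<close> is correct for both \<open>a \<le> b\<close>, the two squared norms
  differ by at most \<epsilon> times their sum. Each is at most \<open>2 * n\<close>, so
  \<open>2 * g * (b - a) \<le> 4 * \<epsilon> * n\<close>.\<close>

lemma card_window_le:
  assumes "0 < \<epsilon>" "0 < g" "2 * (g * G) \<le> n"
  shows "real (card {k. k \<le> G \<and> approximates \<epsilon> (real n + 2 * real (g * k)) r})
    \<le> 2 * \<epsilon> * real n / real g + 1"
proof (rule card_le_diameter)
  fix a b
  assume "a \<in> {k. k \<le> G \<and> approximates \<epsilon> (real n + 2 * real (g * k)) r}"
    and "b \<in> {k. k \<le> G \<and> approximates \<epsilon> (real n + 2 * real (g * k)) r}"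
  hence a: "a \<le> G" "r \<le> (1 + \<epsilon>) * (real n + 2 * real (g * a))"
    and b: "b \<le> G" "(1 - \<epsilon>) * (real n + 2 * real (g * b)) \<le> r"
    by (auto simp: approximates_def)
  have bound: "2 * real (g * k) \<le> real n" if "k \<le> G" for k
  proof -
    have "2 * (g * k) \<le> n"
      using that assms(3) by (meson le_trans mult_le_mono2)
    thus ?thesis by linarith
  qed
  have "2 * real (g * b) - 2 * real (g * a)
      \<le> \<epsilon> * (2 * real n + 2 * real (g * a) + 2 * real (g * b))"
    using a(2) b(2) by (simp add: algebra_simps)
  also have "\<dots> \<le> \<epsilon> * (4 * real n)"
    using bound[OF a(1)] bound[OF b(1)] \<open>0 < \<epsilon>\<close> by (intro mult_left_mono) linarith+
  finally have "real g * (real b - real a) \<le> 2 * \<epsilon> * real n"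
    by (simp add: algebra_simps)
  thus "real b - real a \<le> 2 * \<epsilon> * real n / real g"
    using \<open>0 < g\<close> by (simp add: pos_le_divide_eq mult.commute)
qed (use assms in auto)

lemma quadratic_lower_bound:
  assumes \<epsilon>: "0 < \<epsilon>" and X: "X = min (1 / \<epsilon>\<^sup>2) (real n)" and large: "3000000 \<le> X"
    and alg: "randomized_query_alg n M" "estimates_frobenius_sq n \<epsilon> M"
  shows "\<exists>A. psd_mat n A \<and> A \<noteq> 0\<^sub>m n n \<and>
           (\<exists>t \<in> space M. real n * X / 10 ^ 8 \<le> real (card (entries_read A t)))"
proof (rule ccontr)
  assume *: "\<not> ?thesis"
  define q where "q = real n * X / 10 ^ 8"
  have few: "real (card (entries_read A t)) \<le> q"
    if "psd_mat n A" "A \<noteq> 0\<^sub>m n n" "t \<in> space M" for A t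
    using * that unfolding q_def by (meson not_less less_imp_le)
  define m where "m = n div 2"
  \<comment> \<open>As \<open>14400 = 120\<^sup>2\<close>, this choice gives
    \<open>\<epsilon> * sqrt G \<le> 1 / 120\<close>, which makes the window of correct values short
    compared with \<open>sqrt G\<close>.\<close>
  define G where "G = nat \<lfloor>X / 14400\<rfloor>"
  define g where "g = m div G"
  \<comment> \<open>Both \<open>h + 1\<close> and \<open>G - h\<close> are at least
    \<open>G / 2\<close>: exceeding \<open>h\<close> takes many hits, and otherwise many bits stay
    hidden.\<close>
  define h where "h = G div 2"
  have "X \<le> real n" and "X \<le> 1 / \<epsilon>\<^sup>2"
    by (simp_all add: X)
  have n: "3000000 \<le> real n"
    using large \<open>X \<le> real n\<close> by linarith
  have mn: "2 * m \<le> n" and m3: "real n \<le> 3 * real m"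
    using n unfolding m_def by linarith+
  have GX: "real G \<le> X / 14400" "X / 14400 - 1 \<le> real G"
    using large unfolding G_def by linarith+
  have G200: "200 \<le> real G" and G: "X \<le> 28800 * real G"
    using GX(2) large by linarith+
  have "0 < G" "h < G"
    using G200 unfolding h_def by linarith+
  have "G \<le> 2 * (h + 1)" "G \<le> 2 * (G - h)"
    unfolding h_def by simp_all
  hence h: "real G \<le> 2 * real (h + 1)" "real G \<le> 2 * real (G - h)"
    by linarith+
  have Gm: "2 * real G \<le> real m"
    using GX(1) \<open>X \<le> real n\<close> m3 n by linarith
  have hm: "4 * (h + 1) \<le> m"
  proof -
    have "real (4 * (h + 1)) \<le> 2 * real G + 4"
      unfolding h_def by simp
    also have "\<dots> \<le> real m"
      using GX(1) \<open>X \<le> real n\<close> m3 n by linarith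
    finally show ?thesis by linarith
  qed
  have gG: "g * G \<le> m"
    by (simp add: g_def)
  have "0 < g"
    using Gm \<open>0 < G\<close> by (simp add: g_def div_greater_zero_iff)
  have "m < g * G + G"
    using \<open>0 < G\<close> unfolding g_def by (metis add.commute mod_less_divisor div_mult_mod_eq add_less_cancel_left)
  hence "real m < real (g * G) + real G"
    by linarith
  \<comment> \<open>Rounding in \<open>g\<close> loses fewer than \<open>G\<close> vertices, and
    \<open>G \<le> m / 2\<close>.\<close>
  hence mg: "real m \<le> 2 * (real g * real G)"
    using Gm by simp
  define w where "w = 2 * \<epsilon> * real n / real g + 1"
  have w: "w \<le> 1 / 4 * sqrt (real (G - h))"
  proof -
    have "w \<le> 12 * \<epsilon> * real G + 1"
    proof -
      have "real n \<le> 6 * real G * real g"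
        using mg m3 by (simp add: mult_ac)
      hence "2 * \<epsilon> * real n \<le> 2 * \<epsilon> * (6 * real G * real g)"
        using \<epsilon> by (intro mult_left_mono) auto
      hence "2 * \<epsilon> * real n \<le> 12 * \<epsilon> * real G * real g"
        by (simp add: mult_ac)
      thus ?thesis
        using \<open>0 < g\<close> by (simp add: w_def pos_divide_le_eq)
    qed
    also have "12 * \<epsilon> * real G \<le> sqrt (real G) / 10"
    proof -
      have "(120 * \<epsilon>)\<^sup>2 * real G \<le> (120 * \<epsilon>)\<^sup>2 * (1 / \<epsilon>\<^sup>2 / 14400)"
        using GX(1) \<open>X \<le> 1 / \<epsilon>\<^sup>2\<close> by (intro mult_left_mono) auto
      also have "\<dots> = 1"
        using \<epsilon> by (simp add: power_mult_distrib)
      finally have "sqrt ((120 * \<epsilon>)\<^sup>2 * real G) \<le> 1"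
        by simp
      hence "120 * \<epsilon> * sqrt (real G) \<le> 1"
        using \<epsilon> by (simp add: real_sqrt_mult)
      hence "120 * \<epsilon> * sqrt (real G) * sqrt (real G) \<le> 1 * sqrt (real G)"
        by (intro mult_right_mono) auto
      thus ?thesis by (simp add: mult.assoc)
    qed
    \<comment> \<open>\<open>G \<ge> 200\<close> absorbs the summand 1 of the window. The total
      factor \<open>1 / 10 + 71 / 1000 = 171 / 1000\<close> is just below
      \<open>1 / (4 * sqrt 2)\<close>, as needed for \<open>G - h \<ge> G / 2\<close>.\<close>
    also have "1 \<le> 71 / 1000 * sqrt (real G)"
    proof -
      have "1000 / 71 \<le> sqrt (real G)"
        using G200 by (intro real_le_rsqrt) (simp add: power2_eq_square)
      thus ?thesis by simp
    qed
    also have "sqrt (real G) / 10 + 71 / 1000 * sqrt (real G) = sqrt ((171 / 1000)\<^sup>2 * real G)"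
      by (simp add: real_sqrt_mult)
    also have "\<dots> \<le> sqrt ((1 / 4)\<^sup>2 * real (G - h))"
      using h(2) by (intro real_sqrt_le_mono) (simp add: power2_eq_square)
    also have "\<dots> = 1 / 4 * sqrt (real (G - h))"
      by (subst real_sqrt_mult) simp
    finally show ?thesis by simp
  qed
  \<comment> \<open>Lucky guesses and runs with many hits contribute at most \<open>1 / 4\<close>
    each, so the success rate stays below the required \<open>2 / 3\<close>.\<close>
  have ratio: "w / sqrt (real (G - h)) + 12 * q / (real m * real (h + 1)) \<le> 1 / 2"
  proof -
    have "w / sqrt (real (G - h)) \<le> 1 / 4"
      using w \<open>h < G\<close> by (simp add: pos_divide_le_eq)
    moreover have "12 * q / (real m * real (h + 1)) \<le> 1 / 4"
    proof -
      have "X \<le> 57600 * real (h + 1)"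
        using G h(1) by linarith
      hence "real n * X \<le> (3 * real m) * (57600 * real (h + 1))"
        using m3 large by (intro mult_mono) auto
      also have "\<dots> = 172800 * (real m * real (h + 1))" by simp
      finally have "q \<le> 172800 * (real m * real (h + 1)) / 10 ^ 8"
        unfolding q_def by (rule divide_right_mono) simp
      moreover have pos: "0 < real m * real (h + 1)"
        using Gm G200 by simp
      hence "172800 * (real m * real (h + 1)) / 10 ^ 8 \<le> 1 / 48 * (real m * real (h + 1))"
        by simp
      ultimately have "12 * q \<le> 1 / 4 * (real m * real (h + 1))"
        by linarith
      thus ?thesis
        using pos by (simp only: pos_divide_le_eq)
    qed
    ultimately show ?thesis by linarith
  qed
  define \<F> where "\<F> = {\<sigma>. \<sigma> permutes {..<m}} \<times> Pow {..<G}"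
  define B where "B y = matching_mat m n (fst y) (\<lambda>i. i div g \<in> snd y)"
    for y :: "(nat \<Rightarrow> nat) \<times> nat set"
  have fin: "finite \<F>"
    unfolding \<F>_def by (simp add: finite_permutations)
  have card\<F>: "real (card \<F>) = fact m * 2 ^ G"
    by (simp add: \<F>_def card_cartesian_product card_permutations card_Pow)
  have B: "psd_mat n (B y)" "B y \<noteq> 0\<^sub>m n n" if "y \<in> \<F>" for y
    using that mn n unfolding \<F>_def B_def
    by (auto intro!: psd_matching_mat matching_mat_nonzero)
  have frob: "(frobenius_norm (B (\<sigma>, S)))\<^sup>2 = real n + 2 * real (g * card S)"
    if "\<sigma> permutes {..<m}" "S \<subseteq> {..<G}" for \<sigma> S
    using frobenius_matching_mat[OF that(1) mn, of "\<lambda>i. i div g \<in> S"]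
      card_blocks[OF that(2) gG \<open>0 < g\<close>] by (simp add: B_def)
  obtain t where t: "t \<in> space M" and within: "queries_within n t"
    and often: "2 / 3 * real (card \<F>)
       \<le> real (card {y \<in> \<F>. approximates \<epsilon> ((frobenius_norm (B y))\<^sup>2) (output_on (B y) t)})"
    by (rule deterministic_alg_good_on_average[OF alg fin B])
  define T where "T = to_tree m t"
  define Q where "Q r k \<longleftrightarrow> approximates \<epsilon> (real n + 2 * real (g * k)) r" for r k
  have correct: "{y \<in> \<F>. approximates \<epsilon> ((frobenius_norm (B y))\<^sup>2) (output_on (B y) t)}
      = {(\<sigma>, S). \<sigma> permutes {..<m} \<and> S \<subseteq> {..<G} \<and>
            Q (tree_output (edge \<sigma> (\<lambda>i. i div g \<in> S)) T) (card S)}"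
    using frob to_tree_matching_mat(1)[OF _ mn within]
    by (auto simp: \<F>_def Q_def T_def B_def)
  have "real (card {(\<sigma>, S). \<sigma> permutes {..<m} \<and> S \<subseteq> {..<G} \<and>
            Q (tree_output (edge \<sigma> (\<lambda>i. i div g \<in> S)) T) (card S)})
      \<le> (w / sqrt (real (G - h)) + 12 * q / (real m * real (h + 1))) * (fact m * 2 ^ G)"
  proof (rule card_correct_le)
    show "0 < m" using Gm G200 by linarith
    show "real (card {k. k \<le> G \<and> Q r k}) \<le> w" for r
      unfolding Q_def w_def using \<epsilon> \<open>0 < g\<close> gG mn by (intro card_window_le) auto
    show "real (card (tree_reads (edge \<sigma> (\<lambda>i. i div g \<in> S)) T)) \<le> q"
      if "\<sigma> permutes {..<m}" "S \<subseteq> {..<G}" for \<sigma> S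
    proof -
      have "card (tree_reads (edge \<sigma> (\<lambda>i. i div g \<in> S)) T) \<le> card (entries_read (B (\<sigma>, S)) t)"
        unfolding T_def B_def using card_to_tree_reads_le[OF that(1) mn within] by simp
      moreover have "real (card (entries_read (B (\<sigma>, S)) t)) \<le> q"
        using that by (intro few B t) (auto simp: \<F>_def)
      ultimately show ?thesis by linarith
    qed
  qed (use hm \<open>h < G\<close> in \<open>auto simp: T_def tree_within_to_tree\<close>)
  also have "\<dots> \<le> 1 / 2 * real (card \<F>)"
    unfolding card\<F> by (rule mult_right_mono[OF ratio]) simp
  finally have "2 / 3 * real (card \<F>) \<le> 1 / 2 * real (card \<F>)"
    using often[unfolded correct] by (rule order_trans[rotated])
  moreover have "0 < real (card \<F>)"
    by (simp add: card\<F>)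
  ultimately show False by linarith
qed

theorem theorem7:
  shows "\<exists>c::real. c > 0 \<and> (\<exists>n\<^sub>0::nat. n\<^sub>0 \<ge> 1 \<and>
    (\<forall>n::nat. n \<ge> n\<^sub>0 \<longrightarrow> (\<forall>\<epsilon>::real. 0 < \<epsilon> \<and> \<epsilon> < 1 / 2 \<longrightarrow>
      (\<forall>M::query_alg measure.
         randomized_query_alg n M \<and> estimates_frobenius_sq n \<epsilon> M \<longrightarrow>
         (\<exists>A. psd_mat n A \<and> A \<noteq> 0\<^sub>m n n \<and>
            (\<exists>t \<in> space M.
               real (card (entries_read A t)) \<ge> c * min (real n / \<epsilon>\<^sup>2) ((real n)\<^sup>2)))))))"
proof (intro exI[of _ "1 / 10 ^ 8"] exI[of _ 4] conjI allI impI)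
  fix n :: nat and \<epsilon> :: real and M :: "query_alg measure"
  assume n: "4 \<le> n" and "0 < \<epsilon> \<and> \<epsilon> < 1 / 2"
    and "randomized_query_alg n M \<and> estimates_frobenius_sq n \<epsilon> M"
  hence \<epsilon>: "0 < \<epsilon>" "\<epsilon> < 1 / 2"
    and alg: "randomized_query_alg n M" "estimates_frobenius_sq n \<epsilon> M"
    by simp_all
  define X where "X = min (1 / \<epsilon>\<^sup>2) (real n)"
  have bound: "1 / 10 ^ 8 * min (real n / \<epsilon>\<^sup>2) ((real n)\<^sup>2) = real n * X / 10 ^ 8"
    unfolding X_def by (simp add: min_mult_distrib_left power2_eq_square)
  show "\<exists>A. psd_mat n A \<and> A \<noteq> 0\<^sub>m n n \<and>
      (\<exists>t \<in> space M. 1 / 10 ^ 8 * min (real n / \<epsilon>\<^sup>2) ((real n)\<^sup>2) \<le> real (card (entries_read A t)))"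
  \<comment> \<open>From this threshold on, \<open>X / 14400\<close> leaves at least 200 groups
    after rounding. Below it, \<open>X / 10 ^ 8\<close> is less than \<open>1 / 4\<close>, so the
    linear bound suffices.\<close>
  proof (cases "3000000 \<le> X")
    case True
    show ?thesis
      unfolding bound by (rule quadratic_lower_bound[OF \<epsilon>(1) X_def True alg])
  next
    case False
    have "real n * X \<le> real n * 3000000"
      using False by (intro mult_left_mono) auto
    also have "\<dots> \<le> real n * 25000000"
      by simp
    finally have "real n * X / 10 ^ 8 \<le> real n / 4"
      by (simp add: mult.commute)
    thus ?thesis
      unfolding bound using linear_lower_bound[OF n \<epsilon> alg] by (meson order_trans)
  qed
qed simp_all

end
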